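(* Let $\mathcal F$ be a nonempty balanced-linearly invariant class of target-affine equivalence classes of univalent orientation-preserving harmonic mappings in $\mathbb D$ with $\|\omega_f\|_\infty<1$, and suppose there is $k_0<1$ such that $\|G'/H'\|_\infty\le k_0$ for every $F=H+\overline G\in\mathcal F^\flat$. Then $$\left|\alpha_\flat(\mathcal F)-\sigma_\flat(\mathcal F)\right|\le\frac12\,\mathcal C(k_0).$$ If the family $\mathcal F^\flat$ is contained in $\mathcal S^\flat(D)$, one may take $k_0=\tanh\frac{J(D)}2$. Consequently, for small $D$ the difference between the two orders is quadratic in the affine defect, i.e. $|\alpha_\flat(\mathcal F)-\sigma_\flat(\mathcal F)|\le\frac12\,\mathcal C\bigl(\tanh\tfrac{J(D)}2\bigr)=O(D^2)$ as $D\to0$ for such families with $\mathcal F^\flat\subset\mathcal S^\flat(D)$.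
   Context: $\mathbb D$ is the open unit disk in $\mathbb C$. An orientation-preserving harmonic mapping in $\mathbb D$ is a complex-valued harmonic function $f=h+\overline g$, with $h,g$ analytic in $\mathbb D$, whose Jacobian $J_f=|h'|^2-|g'|^2$ is positive everywhere; its complex dilatation $\omega_f=g'/h'$ is an analytic map $\mathbb D\to\mathbb D$. Univalent means injective. $\|\cdot\|_\infty$ is the supremum norm on $\mathbb D$. $P_f=(\log J_f)_z=\frac{h''}{h'}-\frac{\overline{\omega_f}\omega_f'}{1-|\omega_f|^2}$ is the pre-Schwarzian. Orientation-preserving real-affine mappings: $A(w)=aw+b\overline w+c$, $|a|>|b|$; the target-affine equivalence class $[f]$ is $\{A\circ f\}$ over all such $A$. Hyperbolic distance: $d_{\mathbb D}(z_1,z_2)=2\operatorname{arctanh}\left|\frac{z_1-z_2}{1-\overline{z_2}z_1}\right|$. A nonempty hyperbolically bounded $E\subset\mathbb D$ has a unique circumcenter, the minimizer over $c\in\mathbb D$ of $\sup_{\zeta\in E}d_{\mathbb D}(c,\zeta)$. $c_{\mathrm{aff}}(f)$ and $d_{\mathrm{aff}}(f)$ are the circumcenter and hyperbolic diameter of $\overline{\omega_f(\mathbb D)}$. Canonical balanced representative: $\mathscr B[f](z)=\frac{A(f(z))-A(f(0))}{(A\circ f)_z(0)}$ for any orientation-preserving real-affine $A$ with $c_{\mathrm{aff}}(A\circ f)=0$; it is independent of $A$ and depends only on $[f]$. Balanced section: $\mathcal F^\flat=\{\mathscr B[f]:[f]\in\mathcal F\}$. $\mathcal F$ (or $\mathcal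 F^\flat$) is balanced-linearly invariant if $\mathscr B[F\circ\phi]\in\mathcal F^\flat$ for all $F\in\mathcal F^\flat$, $\phi\in\operatorname{Aut}(\mathbb D)$. Members are written $F=H+\overline G$ with $F(0)=0$, $H(z)=z+a_2(F)z^2+\cdots$. Orders: $\alpha_\flat(\mathcal F)=\sup_{F\in\mathcal F^\flat}|a_2(F)|$, $\sigma_\flat(\mathcal F)=\frac12\sup_{F\in\mathcal F^\flat}|P_F(0)|$. $\mathcal S^\flat(D)=\{\mathscr B[f]: f \text{ univalent orientation-preserving harmonic in }\mathbb D,\ \|\omega_f\|_\infty<1,\ d_{\mathrm{aff}}(f)\le D\}$, $J(D)=\operatorname{arcsinh}\left(\frac2{\sqrt3}\sinh\frac D2\right)$. $\mathcal C(0)=0$ and for $0<k<1$, $\mathcal C(k)=\frac{2x_k^{3/2}}{k(1+x_k)}$ with $x_k=\frac{3-k^2-\sqrt{(1-k^2)(9-k^2)}}2$. *)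

theory Defs
  imports "HOL-Complex_Analysis.Complex_Analysis" "HOL-Library.Landau_Symbols"
begin

abbreviation unit_disk :: "complex set" where
  "unit_disk \<equiv> ball 0 1"

text \<open>
  Mappings of the disk are total functions on \<^typ>\<open>complex\<close> of which only the values on
  \<^term>\<open>unit_disk\<close> matter: every notion below depends on a mapping through these values only.
\<close>

section \<open>Harmonic mappings\<close>

text \<open>
  The condition \<open>g 0 = 0\<close> is no restriction (move a constant into \<open>h\<close>); it makes the
  decomposition unique on the disk.
\<close>

definition harmonic_decomp :: "(complex \<Rightarrow> complex) \<Rightarrow> (complex \<Rightarrow> complex) \<Rightarrow> (complex \<Rightarrow> complex) \<Rightarrow> bool" where
  "harmonic_decomp f h g \<longleftrightarrow>
     h holomorphic_on unit_disk \<and> g holomorphic_on unit_disk \<and> g 0 = 0 \<and>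
     (\<forall>z\<in>unit_disk. f z = h z + cnj (g z))"

definition analytic_part :: "(complex \<Rightarrow> complex) \<Rightarrow> complex \<Rightarrow> complex" where
  "analytic_part f = (SOME h. \<exists>g. harmonic_decomp f h g)"

definition coanalytic_part :: "(complex \<Rightarrow> complex) \<Rightarrow> complex \<Rightarrow> complex" where
  "coanalytic_part f = (SOME g. harmonic_decomp f (analytic_part f) g)"

definition harmonic_jacobian :: "(complex \<Rightarrow> complex) \<Rightarrow> complex \<Rightarrow> real" where
  "harmonic_jacobian f z = (cmod (deriv (analytic_part f) z))\<^sup>2 - (cmod (deriv (coanalytic_part f) z))\<^sup>2"

definition op_harmonic :: "(complex \<Rightarrow> complex) \<Rightarrow> bool" where
  "op_harmonic f \<longleftrightarrow> (\<exists>h g. harmonic_decomp f h g) \<and> (\<forall>z\<in>unit_disk. harmonic_jacobian f z > 0)"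

definition univalent :: "(complex \<Rightarrow> complex) \<Rightarrow> bool" where
  "univalent f \<longleftrightarrow> inj_on f unit_disk"

definition dilatation :: "(complex \<Rightarrow> complex) \<Rightarrow> complex \<Rightarrow> complex" where
  "dilatation f z = deriv (coanalytic_part f) z / deriv (analytic_part f) z"

text \<open>
  A real supremum; it is only applied to dilatations of orientation-preserving mappings, which
  are bounded by 1.
\<close>

definition disk_norm :: "(complex \<Rightarrow> complex) \<Rightarrow> real" where
  "disk_norm w = (SUP z\<in>unit_disk. cmod (w z))"

text \<open>The Wirtinger derivative \<open>f\<^sub>z = (f\<^sub>x - \<i> f\<^sub>y) / 2\<close>.\<close>

definition wirtinger :: "(complex \<Rightarrow> complex) \<Rightarrow> complex \<Rightarrow> complex" where
  "wirtinger f z = (frechet_derivative f (at z) 1 - \<i> * frechet_derivative f (at z) \<i>) / 2"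

definition pre_schwarzian :: "(complex \<Rightarrow> complex) \<Rightarrow> complex \<Rightarrow> complex" where
  "pre_schwarzian f z = wirtinger (\<lambda>w. of_real (ln (harmonic_jacobian f w))) z"

section \<open>Hyperbolic geometry of the disk\<close>

definition hyp_dist :: "complex \<Rightarrow> complex \<Rightarrow> real" where
  "hyp_dist z1 z2 = 2 * artanh (cmod ((z1 - z2) / (1 - cnj z2 * z1)))"

definition circumcenter :: "complex set \<Rightarrow> complex" where
  "circumcenter E =
     (THE c. is_arg_min (\<lambda>c. SUP \<zeta>\<in>E. hyp_dist c \<zeta>) (\<lambda>c. c \<in> unit_disk) c)"

definition hyp_diameter :: "complex set \<Rightarrow> real" where
  "hyp_diameter E = (SUP (z1, z2)\<in>E \<times> E. hyp_dist z1 z2)"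

definition c_aff :: "(complex \<Rightarrow> complex) \<Rightarrow> complex" where
  "c_aff f = circumcenter (closure (dilatation f ` unit_disk))"

definition d_aff :: "(complex \<Rightarrow> complex) \<Rightarrow> real" where
  "d_aff f = hyp_diameter (closure (dilatation f ` unit_disk))"

section \<open>Target-affine classes and balanced representatives\<close>

definition op_affine :: "(complex \<Rightarrow> complex) \<Rightarrow> bool" where
  "op_affine A \<longleftrightarrow> (\<exists>a b c. cmod b < cmod a \<and> A = (\<lambda>w. a * w + b * cnj w + c))"

definition aff_class :: "(complex \<Rightarrow> complex) \<Rightarrow> (complex \<Rightarrow> complex) set" where
  "aff_class f = {u. \<exists>A. op_affine A \<and> (\<forall>z\<in>unit_disk. u z = A (f z))}"

text \<open>
  The result is restricted to the disk, so that a balanced representative is determined as a HOL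
  function by its values on the disk. It does not depend on the chosen \<open>A\<close>.
\<close>

definition balanced_rep :: "(complex \<Rightarrow> complex) \<Rightarrow> complex \<Rightarrow> complex" where
  "balanced_rep f =
     (let A = SOME A. op_affine A \<and> c_aff (A \<circ> f) = 0
      in (\<lambda>z\<in>unit_disk. (A (f z) - A (f 0)) / wirtinger (A \<circ> f) 0))"

definition admissible :: "(complex \<Rightarrow> complex) \<Rightarrow> bool" where
  "admissible f \<longleftrightarrow> op_harmonic f \<and> univalent f \<and> disk_norm (dilatation f) < 1"

definition balanced_section :: "(complex \<Rightarrow> complex) set set \<Rightarrow> (complex \<Rightarrow> complex) set" where
  "balanced_section \<F> = {balanced_rep f | f. aff_class f \<in> \<F>}"

definition disk_automorphism :: "(complex \<Rightarrow> complex) \<Rightarrow> bool" where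
  "disk_automorphism \<phi> \<longleftrightarrow> \<phi> holomorphic_on unit_disk \<and> bij_betw \<phi> unit_disk unit_disk"

definition balanced_linearly_invariant :: "(complex \<Rightarrow> complex) set set \<Rightarrow> bool" where
  "balanced_linearly_invariant \<F> \<longleftrightarrow>
     (\<forall>F\<in>balanced_section \<F>. \<forall>\<phi>. disk_automorphism \<phi> \<longrightarrow>
        balanced_rep (F \<circ> \<phi>) \<in> balanced_section \<F>)"

definition invariant_class :: "(complex \<Rightarrow> complex) set set \<Rightarrow> bool" where
  "invariant_class \<F> \<longleftrightarrow>
     \<F> \<noteq> {} \<and> \<F> \<subseteq> {aff_class f | f. admissible f} \<and> balanced_linearly_invariant \<F>"

definition S_balanced :: "real \<Rightarrow> (complex \<Rightarrow> complex) set" where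
  "S_balanced D = {balanced_rep f | f. admissible f \<and> d_aff f \<le> D}"

section \<open>Orders\<close>

definition a2 :: "(complex \<Rightarrow> complex) \<Rightarrow> complex" where
  "a2 F = (deriv ^^ 2) (analytic_part F) 0 / fact 2"

text \<open>
  The orders are suprema in the extended reals. A bound on \<^term>\<open>\<bar>\<alpha> - \<sigma>\<bar>\<close> by a real number
  includes their finiteness, since \<^term>\<open>\<infinity> - \<infinity> = (\<infinity> :: ereal)\<close>.
\<close>

definition alpha_order :: "(complex \<Rightarrow> complex) set set \<Rightarrow> ereal" where
  "alpha_order \<F> = (SUP F\<in>balanced_section \<F>. ereal (cmod (a2 F)))"

definition sigma_order :: "(complex \<Rightarrow> complex) set set \<Rightarrow> ereal" where
  "sigma_order \<F> = ereal (1 / 2) * (SUP F\<in>balanced_section \<F>. ereal (cmod (pre_schwarzian F 0)))"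

definition jung_radius :: "real \<Rightarrow> real" where
  "jung_radius D = arsinh (2 / sqrt 3 * sinh (D / 2))"

definition order_gap :: "real \<Rightarrow> real" where
  "order_gap k =
     (if k = 0 then 0
      else let x = (3 - k\<^sup>2 - sqrt ((1 - k\<^sup>2) * (9 - k\<^sup>2))) / 2
           in 2 * x powr (3 / 2) / (k * (1 + x)))"

section \<open>Consistency of the definitions\<close>

lemma harmonic_decomp_parts:
  assumes "harmonic_decomp f h g"
  shows "harmonic_decomp f (analytic_part f) (coanalytic_part f)"
proof -
  have "\<exists>g. harmonic_decomp f (analytic_part f) g"
    unfolding analytic_part_def using assms by (intro someI_ex[of "\<lambda>h. \<exists>g. harmonic_decomp f h g"]) blast
  then show ?thesis
    unfolding coanalytic_part_def by (rule someI_ex)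
qed

lemma wirtinger_eqI:
  assumes "(f has_derivative (\<lambda>v. p * v + cnj (q * v))) (at z)"
  shows "wirtinger f z = p"
proof -
  have "frechet_derivative f (at z) = (\<lambda>v. p * v + cnj (q * v))"
    using frechet_derivative_at[OF assms] by simp
  then show ?thesis
    by (simp add: wirtinger_def algebra_simps flip: mult.assoc)
qed

lemma wirtinger_harmonic:
  assumes "harmonic_decomp f h g" "z \<in> unit_disk"
  shows "wirtinger f z = deriv h z"
proof (rule wirtinger_eqI)
  have "(h has_derivative (\<lambda>v. deriv h z * v)) (at z)" "(g has_derivative (\<lambda>v. deriv g z * v)) (at z)"
    using assms holomorphic_derivI[OF _ open_ball]
    by (auto simp: harmonic_decomp_def has_field_derivative_def)
  then have "((\<lambda>w. h w + cnj (g w)) has_derivative (\<lambda>v. deriv h z * v + cnj (deriv g z * v))) (at z)"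
    by (intro has_derivative_add has_derivative_cnj)
  then show "(f has_derivative (\<lambda>v. deriv h z * v + cnj (deriv g z * v))) (at z)"
    by (rule has_derivative_transform_within_open[where s = unit_disk])
       (use assms in \<open>auto simp: harmonic_decomp_def\<close>)
qed

lemma has_derivative_cmod_square:
  assumes "(F has_field_derivative F') (at z)"
  shows "((\<lambda>w. (cmod (F w))\<^sup>2) has_derivative (\<lambda>v. 2 * Re (cnj (F z) * F' * v))) (at z)"
proof -
  have F: "(F has_derivative (\<lambda>v. F' * v)) (at z)"
    using assms by (simp add: has_field_derivative_def)
  show ?thesis
    unfolding cmod_power2
    by (rule derivative_eq_intros has_derivative_Re has_derivative_Im F refl ext)+
       (simp add: algebra_simps)
qed

lemma pre_schwarzian_formula:
  assumes f: "op_harmonic f" and z: "z \<in> unit_disk"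
  defines "h \<equiv> analytic_part f" and "\<omega> \<equiv> dilatation f"
  shows "pre_schwarzian f z =
    deriv (deriv h) z / deriv h z - cnj (\<omega> z) * deriv \<omega> z / (1 - of_real ((cmod (\<omega> z))\<^sup>2))"
proof -
  define g where "g = coanalytic_part f"
  have "harmonic_decomp f h g"
    using f harmonic_decomp_parts unfolding op_harmonic_def h_def g_def by blast
  then have hg: "deriv h holomorphic_on unit_disk" "deriv g holomorphic_on unit_disk"
    by (auto simp: harmonic_decomp_def intro: holomorphic_deriv)
  have dh: "(deriv h has_field_derivative deriv (deriv h) z) (at z)"
   and dg: "(deriv g has_field_derivative deriv (deriv g) z) (at z)"
    using hg z holomorphic_derivI[OF _ open_ball] by auto
  have Jdef: "harmonic_jacobian f = (\<lambda>w. (cmod (deriv h w))\<^sup>2 - (cmod (deriv g w))\<^sup>2)"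
    by (simp add: harmonic_jacobian_def h_def g_def fun_eq_iff)
  have Jpos: "harmonic_jacobian f z > 0"
    using f z by (simp add: op_harmonic_def)
  define q where "q = (cnj (deriv h z) * deriv (deriv h) z - cnj (deriv g z) * deriv (deriv g) z)
    / of_real (harmonic_jacobian f z)"
  have dJ: "(harmonic_jacobian f has_derivative
      (\<lambda>v. 2 * Re (cnj (deriv h z) * deriv (deriv h) z * v)
         - 2 * Re (cnj (deriv g z) * deriv (deriv g) z * v))) (at z)"
    unfolding Jdef by (intro has_derivative_diff has_derivative_cmod_square dh dg)
  have "((\<lambda>w. complex_of_real (ln (harmonic_jacobian f w))) has_derivative
      (\<lambda>v. of_real ((2 * Re (cnj (deriv h z) * deriv (deriv h) z * v)
         - 2 * Re (cnj (deriv g z) * deriv (deriv g) z * v)) * inverse (harmonic_jacobian f z)))) (at z)"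
    by (intro has_derivative_of_real has_derivative_ln Jpos dJ)
  also have "(\<lambda>v. complex_of_real ((2 * Re (cnj (deriv h z) * deriv (deriv h) z * v)
         - 2 * Re (cnj (deriv g z) * deriv (deriv g) z * v)) * inverse (harmonic_jacobian f z)))
      = (\<lambda>v. q * v + cnj (q * v))"
  proof
    fix v
    have "q * v + cnj (q * v) = of_real (2 * Re (q * v))"
      by (simp add: complex_eq_iff)
    also have "Re (q * v) = Re ((cnj (deriv h z) * deriv (deriv h) z * v
        - cnj (deriv g z) * deriv (deriv g) z * v) / of_real (harmonic_jacobian f z))"
      by (simp add: q_def algebra_simps)
    also have "\<dots> = (Re (cnj (deriv h z) * deriv (deriv h) z * v)
         - Re (cnj (deriv g z) * deriv (deriv g) z * v)) * inverse (harmonic_jacobian f z)"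
      by (simp only: Re_divide_of_real minus_complex.sel) (simp only: divide_inverse)
    finally show "complex_of_real ((2 * Re (cnj (deriv h z) * deriv (deriv h) z * v)
         - 2 * Re (cnj (deriv g z) * deriv (deriv g) z * v)) * inverse (harmonic_jacobian f z)) = q * v + cnj (q * v)"
      by (simp add: algebra_simps)
  qed
  finally have P: "pre_schwarzian f z = q"
    unfolding pre_schwarzian_def by (rule wirtinger_eqI)
  have hz: "deriv h z \<noteq> 0"
    using Jpos unfolding Jdef by auto
  have \<omega>: "\<omega> = (\<lambda>w. deriv g w / deriv h w)"
    by (simp add: \<omega>_def dilatation_def h_def g_def fun_eq_iff)
  have \<omega>': "deriv \<omega> z = (deriv (deriv g) z * deriv h z - deriv g z * deriv (deriv h) z)
      / (deriv h z * deriv h z)"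
    unfolding \<omega> by (intro DERIV_imp_deriv DERIV_divide dh dg hz)
  define a b a' b' where "a = deriv h z" and "b = deriv g z"
    and "a' = deriv (deriv h) z" and "b' = deriv (deriv g) z"
  have J: "complex_of_real (harmonic_jacobian f z) = a * cnj a - b * cnj b"
    by (simp add: Jdef a_def b_def complex_mult_cnj cmod_power2)
  have nz: "a \<noteq> 0" "a * cnj a - b * cnj b \<noteq> 0"
    using hz Jpos J by (auto simp: a_def)
  have W: "1 - complex_of_real ((cmod (\<omega> z))\<^sup>2) = (a * cnj a - b * cnj b) / (a * cnj a)"
    using nz unfolding complex_norm_square \<omega> by (simp add: a_def b_def field_simps)
  have "a' / a - cnj (b / a) * ((b' * a - b * a') / (a * a)) / ((a * cnj a - b * cnj b) / (a * cnj a))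
      = a' / a - cnj b * (b' * a - b * a') / (a * (a * cnj a - b * cnj b))"
    using nz by simp
  also have "\<dots> = (cnj a * a' - cnj b * b') / (a * cnj a - b * cnj b)"
    using nz by (simp add: divide_simps) (simp add: algebra_simps)
  finally show ?thesis
    unfolding P q_def J W \<omega>' unfolding \<omega> a_def b_def a'_def b'_def by simp
qed

end

(* For F = H + conj G with H'(0) = 1 and dilatation w, the number a_2(F) - P_F(0)/2 equals
   conj(w(0)) w'(0) / (2 (1 - |w(0)|^2)). The Schwarz-Pick lemma for |w| <= k bounds its modulus by
   half the maximum over 0 <= s <= k of s (k^2 - s^2) / (k (1 - s^2)), and this maximum is C(k).

   The orders themselves are finite by a rescaling argument. If |H''/H'| were large at 0, maximize
   (1/2 - |z|) |H''/H'| and zoom in at the maximum: after normalization H''/H' is nearly 1 and the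
   dilatation nearly constant on a large disk, so the mapping is close to a real-affine image of exp.
   Brouwer's theorem then gives it the same value near 0 and near 2 pi i, contradicting univalence.

   A target-affine change of f acts on its dilatation by a hyperbolic isometry. Balanced
   representatives therefore exist, and k = tanh(J(D)/2) is Jung's theorem in the hyperbolic plane. *)

theory Submission imports Defs begin

section \<open>A priori bound for the second coefficient\<close>

text \<open>The pointwise estimate on \<open>a2 F\<close> and half the pre-Schwarzian does not by
  itself compare the suprema: both could be infinite, and their extended-real difference would then
  be infinite too. Hence a bound on \<open>a2\<close> in terms of k alone is required. Its size is
  irrelevant, so the constants are chosen for simple arithmetic. The zoomed mapping is compared with
  its limit on a fixed disk by explicit Cauchy estimates, so no subsequence is extracted. The
  exponential is the limit because H''/H' = 1 makes H' proportional to exp; its periodicity is what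
  destroys injectivity, and an injective real-affine map cannot undo this. On the hyperbolic side,
  distances enter through cosh^2 of their half, which is rational in the real coordinates of the two
  points. Circumcenters and Jung's inequality thereby become polynomial inequalities in Euclidean
  terms. C(k) is the value at the critical point s = sqrt(x_k); its maximality is certified by a
  polynomial with a double root there.\<close>

lemma exp_perturbation_not_inj:
  fixes f :: "complex \<Rightarrow> complex"
  assumes cont: "continuous_on (cball 0 9) f"
    and close: "\<And>z. z \<in> cball 0 9 \<Longrightarrow> cmod (f z - exp z) \<le> 1 / 4"
  shows "\<not> inj_on f (cball 0 9)"
proof -
  \<comment> \<open>Used for c = 0 and c = 2 pi i. The radius 9 leaves room for a unit disk about
    either point, since 2 pi < 8.\<close>
  have ex: "\<exists>z\<in>cball c 1. f z = 1" if c: "exp c = 1" "cmod c \<le> 8" for c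
  proof -
    have sub: "cball c 1 \<subseteq> cball 0 9"
    proof
      fix x assume "x \<in> cball c 1"
      then show "x \<in> cball 0 9"
        using c norm_triangle_sub[of x c] by (simp add: dist_norm norm_minus_commute)
    qed
    \<comment> \<open>A fixed point satisfies exp z = 1 - (f z - exp z) because exp c = 1, and this
      says f z = 1. Adding c selects the branch of the logarithm with values near c.\<close>
    define T where "T = (\<lambda>z. Ln (1 - (f z - exp z)) + c)"
    have bd: "cmod (f z - exp z) \<le> 1 / 4" if "z \<in> cball c 1" for z
      using close sub that by blast
    have notneg: "1 - (f z - exp z) \<notin> \<real>\<^sub>\<le>\<^sub>0" if "z \<in> cball c 1" for z
    proof -
      have "\<bar>Re (f z - exp z)\<bar> \<le> 1 / 4"
        using bd[OF that] abs_Re_le_cmod order_trans by blast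
      then have "Re (f z - exp z) < 1" by (simp only: abs_le_iff) linarith
      then have "Re (1 - (f z - exp z)) > 0" by simp
      then show ?thesis by (auto simp: complex_nonpos_Reals_iff)
    qed
    have "continuous_on (cball c 1) T"
      unfolding T_def using notneg
      by (intro continuous_intros continuous_on_subset[OF cont sub]) auto
    moreover have "T \<in> cball c 1 \<rightarrow> cball c 1"
    proof
      fix z assume z: "z \<in> cball c 1"
      \<comment> \<open>The argument stays within 1/4 of 1, so the logarithm has modulus at most 1/2
        and \<open>T\<close> maps the disk into itself.\<close>
      have "cmod (Ln (1 + - (f z - exp z))) \<le> 2 * cmod (- (f z - exp z))"
        by (rule norm_Ln_le) (use bd[OF z] in \<open>simp only: norm_minus_cancel\<close>)
      then have "cmod (Ln (1 - (f z - exp z))) \<le> 1"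
        using bd[OF z] norm_minus_cancel[of "f z - exp z"] by (simp only: add_uminus_conv_diff)
      then show "T z \<in> cball c 1"
        by (simp add: T_def dist_norm norm_minus_commute)
    qed
    ultimately obtain z where z: "z \<in> cball c 1" "T z = z"
      using brouwer[of "cball c 1" T] by auto
    have "exp z = exp (T z)" using z by simp
    also have "\<dots> = 1 - (f z - exp z)"
    proof -
      have "1 - (f z - exp z) \<noteq> 0" using notneg[OF z(1)] by (metis complex_nonpos_Reals_iff order_refl zero_complex.sel)
      then have "exp (Ln (1 - (f z - exp z))) = 1 - (f z - exp z)" by (rule exp_Ln)
      then show ?thesis using c by (simp add: T_def exp_add)
    qed
    finally show ?thesis using z by (intro bexI[of _ z]) auto
  qed
  obtain z where z: "z \<in> cball 0 1" "f z = 1"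
    using ex[of 0] by auto
  obtain w where w: "w \<in> cball (2 * of_real pi * \<i>) 1" "f w = 1"
    using ex[of "2 * of_real pi * \<i>"] pi_less_4 by (auto simp: norm_mult)
  \<comment> \<open>A common point would put 2 pi i within distance 2 of 0.\<close>
  have "z \<noteq> w"
  proof
    assume "z = w"
    then have "cmod (2 * of_real pi * \<i>) \<le> 2"
      using z w norm_triangle_ineq4[of "2 * of_real pi * \<i> - w" "- w"]
      by (simp add: dist_norm)
    then show False using pi_gt3 by (simp add: norm_mult)
  qed
  moreover have "z \<in> cball 0 9" using z by simp
  moreover have "w \<in> cball 0 9"
  proof -
    have "cmod w \<le> cmod (2 * of_real pi * \<i>) + cmod (w - 2 * of_real pi * \<i>)"
      by (rule norm_triangle_sub)
    also have "\<dots> \<le> 9"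
      using w pi_less_4 by (simp add: norm_mult dist_norm norm_minus_commute)
    finally show ?thesis by simp
  qed
  ultimately show ?thesis
    using z w by (metis inj_onD)
qed

lemma affine_exp_perturbation_not_inj:
  fixes f :: "complex \<Rightarrow> complex"
  assumes cont: "continuous_on (cball 0 9) f" and b: "cmod b \<le> k" "k < 1"
    and close: "\<And>z. z \<in> cball 0 9 \<Longrightarrow> cmod (f z - (exp z + cnj (b * exp z))) \<le> (1 - k) / 4"
  shows "\<not> inj_on f (cball 0 9)"
proof -
  define d where "d = 1 - (cmod b)\<^sup>2"
  have b1: "cmod b < 1" "0 \<le> cmod b" using b by auto
  have d2: "d = (1 + cmod b) * (1 - cmod b)"
    by (simp add: d_def power2_eq_square algebra_simps)
  have d: "d > 0" using b1 unfolding d2 by (intro mult_pos_pos add_pos_nonneg) auto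
  define I where "I = (\<lambda>v. (v - cnj b * cnj v) / of_real d)"
  have I: "I (w + cnj (b * w)) = w" for w
  proof -
    have "I (w + cnj (b * w)) = w * (1 - b * cnj b) / of_real d"
      by (simp add: I_def algebra_simps)
    also have "1 - b * cnj b = of_real d"
      by (simp add: d_def complex_norm_square del: of_real_power)
    finally show ?thesis using d by simp
  qed
  have Ib: "cmod (I v - I v') \<le> cmod (v - v') / (1 - k)" for v v'
  proof -
    have "I v - I v' = ((v - v') - cnj b * cnj (v - v')) / of_real d"
      by (simp add: I_def algebra_simps diff_divide_distrib add_divide_distrib)
    then have "cmod (I v - I v') = cmod ((v - v') - cnj b * cnj (v - v')) / d"
      using d by (simp add: norm_divide)
    also have "\<dots> \<le> (cmod (v - v') + cmod b * cmod (v - v')) / d"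
      using d norm_triangle_ineq4[of "v - v'" "cnj b * cnj (v - v')"]
      by (intro divide_right_mono) (simp_all add: norm_mult del: complex_cnj_diff)
    also have "\<dots> = (1 + cmod b) * cmod (v - v') / ((1 + cmod b) * (1 - cmod b))"
      unfolding d2 by (simp add: algebra_simps)
    \<comment> \<open>The factor 1 + cmod b cancels against the factorization of \<open>d\<close>,
      which leaves the Lipschitz constant 1 / (1 - cmod b).\<close>
    also have "\<dots> = cmod (v - v') / (1 - cmod b)"
      using b1 by (intro mult_divide_mult_cancel_left) (smt (verit))
    also have "\<dots> \<le> cmod (v - v') / (1 - k)"
      using b by (intro divide_left_mono) auto
    finally show ?thesis .
  qed
  have "\<not> inj_on (I \<circ> f) (cball 0 9)"
  proof (rule exp_perturbation_not_inj)
    show "continuous_on (cball 0 9) (I \<circ> f)"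
      unfolding I_def o_def using d by (intro continuous_intros cont) auto
    fix z :: complex assume z: "z \<in> cball 0 9"
    have "cmod ((I \<circ> f) z - exp z) = cmod (I (f z) - I (exp z + cnj (b * exp z)))"
      by (simp only: I o_def)
    also have "\<dots> \<le> ((1 - k) / 4) / (1 - k)"
      by (rule order_trans[OF Ib divide_right_mono]) (use close[OF z] b in auto)
    also have "\<dots> = 1 / 4" using b by (simp add: divide_simps)
    finally show "cmod ((I \<circ> f) z - exp z) \<le> 1 / 4" using b by simp
  qed
  moreover have "inj I"
  proof (rule inj_on_inverseI[where g = "\<lambda>w. w + cnj (b * w)"])
    fix v
    have "I v + cnj (b * I v) = v * (1 - b * cnj b) / of_real d"
      by (simp add: I_def algebra_simps add_divide_distrib diff_divide_distrib)
    also have "1 - b * cnj b = of_real d"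
      by (simp add: d_def complex_norm_square del: of_real_power)
    finally show "I v + cnj (b * I v) = v" using d by simp
  qed
  ultimately show ?thesis
    using comp_inj_on inj_on_subset by blast
qed

text \<open>Cauchy's estimate on disks of radius R / 2 bounds the derivative by 2 B / R on the half
  disk, and the segment from 0 to z stays there. For fixed z and B the oscillation is thus of order
  1 / R.\<close>

lemma holomorphic_bounded_lipschitz_at_0:
  assumes hol: "\<phi> holomorphic_on ball 0 R" and B: "\<And>z. z \<in> ball 0 R \<Longrightarrow> cmod (\<phi> z) \<le> B"
    and z: "2 * cmod z < R"
  shows "cmod (\<phi> z - \<phi> 0) \<le> 2 * B / R * cmod z"
proof -
  have R: "R > 0" using z norm_ge_zero[of z] by linarith
  have "cmod (\<phi> z - \<phi> 0) \<le> (2 * B / R) * cmod (z - 0)"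
  proof (rule field_differentiable_bound[where S = "ball 0 (R / 2)" and f' = "deriv \<phi>"])
    fix w :: complex assume w: "w \<in> ball 0 (R / 2)"
    then have wR: "w \<in> ball 0 R" using R by auto
    show "(\<phi> has_field_derivative deriv \<phi> w) (at w within ball 0 (R / 2))"
      by (rule has_field_derivative_at_within[OF holomorphic_derivI[OF hol open_ball wR]])
    have sub: "ball w (R / 2) \<subseteq> ball 0 R"
    proof
      fix x assume "x \<in> ball w (R / 2)"
      then show "x \<in> ball 0 R"
        using w norm_triangle_sub[of x w] by (simp add: dist_norm norm_minus_commute)
    qed
    \<comment> \<open>The function is controlled only on the open disk, so the estimate is taken on
      radii r < R / 2, and r tends to R / 2.\<close>
    have "cmod (deriv \<phi> w) \<le> B / (R / 2)"
    proof (rule field_le_epsilon)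
      fix e :: real assume "e > 0"
      have lim: "((\<lambda>r. B / r) \<longlongrightarrow> B / (R / 2)) (at_left (R / 2))"
        using R by (intro tendsto_intros) auto
      have "eventually (\<lambda>r. B / r < B / (R / 2) + e) (at_left (R / 2))"
        by (rule order_tendstoD[OF lim]) (use \<open>e > 0\<close> in simp)
      moreover have "eventually (\<lambda>r. r \<in> {0<..<R / 2}) (at_left (R / 2))"
        using R by (intro eventually_at_leftI[of 0]) auto
      ultimately have "eventually (\<lambda>r. B / r < B / (R / 2) + e \<and> r \<in> {0<..<R/2}) (at_left (R / 2))"
        by eventually_elim auto
      then obtain r where r: "B / r < B / (R / 2) + e" "0 < r" "r < R / 2"
        using eventually_happens'[OF trivial_limit_at_left_real] by fastforce
      have sub': "cball w r \<subseteq> ball 0 R" using sub r by auto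
      have "cmod ((deriv ^^ 1) \<phi> w) \<le> fact 1 * B / r ^ 1"
      proof (rule Cauchy_inequality)
        have hol': "\<phi> holomorphic_on cball w r" by (rule holomorphic_on_subset[OF hol sub'])
        show "\<phi> holomorphic_on ball w r" by (rule holomorphic_on_subset[OF hol' ball_subset_cball])
        show "continuous_on (cball w r) \<phi>" by (rule holomorphic_on_imp_continuous_on[OF hol'])
        fix x assume "cmod (w - x) = r"
        then show "cmod (\<phi> x) \<le> B" by (intro B subsetD[OF sub']) (simp add: dist_norm)
      qed (use r in auto)
      then show "cmod (deriv \<phi> w) \<le> B / (R / 2) + e" using r by simp
    qed
    then show "cmod (deriv \<phi> w) \<le> 2 * B / R" by (simp add: mult.commute)
  qed (use z R in auto)
  then show ?thesis by simp
qed

text \<open>The quotients h2 / h1 and g1 / h1 are bounded on a huge disk, so on the fixed disk of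
  radius 9 they nearly equal their values at the origin, 1 and some b. Integrating h1' = p h1, and
  then h1 and g1, gives h close to exp and g close to b exp, up to constants.\<close>

lemma near_exponential_not_inj:
  fixes h h1 h2 g g1 :: "complex \<Rightarrow> complex"
  assumes dh: "\<And>z. z \<in> ball 0 R \<Longrightarrow> (h has_field_derivative h1 z) (at z)"
    and dh1: "\<And>z. z \<in> ball 0 R \<Longrightarrow> (h1 has_field_derivative h2 z) (at z)"
    and dg: "\<And>z. z \<in> ball 0 R \<Longrightarrow> (g has_field_derivative g1 z) (at z)"
    and nz: "\<And>z. z \<in> ball 0 R \<Longrightarrow> h1 z \<noteq> 0"
    and h2: "\<And>z. z \<in> ball 0 R \<Longrightarrow> cmod (h2 z) \<le> 2 * cmod (h1 z)"
    and g1: "\<And>z. z \<in> ball 0 R \<Longrightarrow> cmod (g1 z) \<le> k * cmod (h1 z)"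
    and init: "h1 0 = 1" "h2 0 = 1" and k: "0 \<le> k" "k < 1"
    and R: "50000 * exp 9 / (1 - k) \<le> R"
  shows "\<not> inj_on (\<lambda>z. h z + cnj (g z)) (ball 0 R)"
proof -
  have "50000 * exp 9 \<le> R * (1 - k)"
    using R k by (simp add: field_simps)
  moreover have e9: "exp 9 \<ge> (1::real)" by simp
  moreover have "R * (1 - k) \<le> R"
  proof -
    have "0 \<le> 50000 * exp 9 / (1 - k)" using k by simp
    then have "0 \<le> R" using R by linarith
    then show ?thesis using k by (simp add: mult_left_le)
  qed
  ultimately have R': "R \<ge> 50000" by linarith
  \<comment> \<open>The Lipschitz estimate with B = 2 and cmod z at most 9 gives 2 * 2 / R * 9 = 36
    / R; it serves for both quotients.\<close>
  define \<epsilon> where "\<epsilon> = 36 / R"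
  have \<epsilon>0: "\<epsilon> > 0" "\<epsilon> \<le> 1 / 1000" using R' by (auto simp: \<epsilon>_def field_simps)
  \<comment> \<open>342 = 162 + 180 adds the errors of h and g found below; 342 * 36 * 4 = 49248
    explains the 50000 in the bound on R.\<close>
  have \<epsilon>: "342 * exp 9 * \<epsilon> \<le> (1 - k) / 4"
  proof -
    have "342 * exp 9 * 36 * 4 \<le> 50000 * exp (9::real)" by simp
    also have "\<dots> \<le> R * (1 - k)" by fact
    finally show ?thesis using R' by (simp add: \<epsilon>_def field_simps)
  qed
  have h1hol: "h1 holomorphic_on ball 0 R" "h holomorphic_on ball 0 R" "g holomorphic_on ball 0 R"
    using dh dh1 dg unfolding holomorphic_on_def field_differentiable_def
    by (blast intro: has_field_derivative_at_within)+
  have h2hol: "h2 holomorphic_on ball 0 R"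
    using holomorphic_deriv[OF h1hol(1) open_ball] DERIV_imp_deriv[OF dh1]
    by (rule holomorphic_transform)
  have g1hol: "g1 holomorphic_on ball 0 R"
    using holomorphic_deriv[OF h1hol(3) open_ball] DERIV_imp_deriv[OF dg]
    by (rule holomorphic_transform)
  define p where "p = (\<lambda>z. h2 z / h1 z)"
  define \<omega> where "\<omega> = (\<lambda>z. g1 z / h1 z)"
  have phol: "p holomorphic_on ball 0 R" and \<omega>hol: "\<omega> holomorphic_on ball 0 R"
    unfolding p_def \<omega>_def using nz by (intro holomorphic_intros h1hol h2hol g1hol; blast)+
  have pb: "cmod (p z) \<le> 2" and \<omega>b: "cmod (\<omega> z) \<le> k" if "z \<in> ball 0 R" for z
    using nz[OF that] h2[OF that] g1[OF that] by (auto simp: p_def \<omega>_def norm_divide divide_simps)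
  have sub: "cball 0 9 \<subseteq> ball (0::complex) R" using R' by auto
  have p1: "cmod (p z - 1) \<le> \<epsilon>" and \<omega>1: "cmod (\<omega> z - \<omega> 0) \<le> \<epsilon>" if z: "z \<in> cball 0 9" for z
  proof -
    have z9: "cmod z \<le> 9" "2 * cmod z < R" using z R' by auto
    have "cmod (p z - p 0) \<le> 2 * 2 / R * cmod z"
      by (rule holomorphic_bounded_lipschitz_at_0[OF phol pb z9(2)])
    also have "\<dots> \<le> 2 * 2 / R * 9" using z9 R' by (intro mult_left_mono) auto
    finally show "cmod (p z - 1) \<le> \<epsilon>" using init by (simp add: p_def \<epsilon>_def)
    have "cmod (\<omega> z - \<omega> 0) \<le> 2 * k / R * cmod z"
      by (rule holomorphic_bounded_lipschitz_at_0[OF \<omega>hol \<omega>b z9(2)])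
    also have "\<dots> \<le> 2 * 2 / R * 9" using z9 R' k by (intro mult_mono divide_right_mono) auto
    finally show "cmod (\<omega> z - \<omega> 0) \<le> \<epsilon>" by (simp add: \<epsilon>_def)
  qed
  have "(\<lambda>z. p z - 1) holomorphic_on ball 0 R" by (intro holomorphic_intros phol)
  then obtain L0 where L0: "\<And>z. z \<in> ball 0 R \<Longrightarrow> (L0 has_field_derivative p z - 1) (at z)"
    using holomorphic_convex_primitive'[of "ball 0 R" "\<lambda>z. p z - 1"] by (auto simp: at_within_open[OF _ open_ball])
  define L where "L = (\<lambda>z. L0 z - L0 0)"
  have L: "(L has_field_derivative p z - 1) (at z)" if "z \<in> ball 0 R" for z
    unfolding L_def using L0[OF that] by (auto intro!: derivative_eq_intros)
  have Lb: "cmod (L z) \<le> 9 * \<epsilon>" if z: "z \<in> cball 0 9" for z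
  proof -
    have "cmod (L z - L 0) \<le> \<epsilon> * cmod (z - 0)"
    proof (rule field_differentiable_bound[where S = "cball 0 9" and f' = "\<lambda>z. p z - 1"])
      fix w :: complex assume "w \<in> cball 0 9"
      then have w: "w \<in> ball 0 R" using sub by blast
      show "(L has_field_derivative p w - 1) (at w within cball 0 9)"
        by (rule has_field_derivative_at_within[OF L[OF w]])
    qed (use p1 z in auto)
    also have "\<dots> \<le> \<epsilon> * 9" using z \<epsilon>0 by (intro mult_left_mono) auto
    finally show ?thesis by (simp add: L_def mult.commute)
  qed
  have q: "h1 z = exp z * exp (L z)" if z: "z \<in> ball 0 R" for z
  proof -
    \<comment> \<open>exp (- z - L z) is the integrating factor of h1' = p h1, so \<open>Q\<close>
      is constant, with value 1 at the origin.\<close>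
    define Q where "Q = (\<lambda>z. h1 z * exp (- z - L z))"
    have "(Q has_field_derivative 0) (at w within ball 0 R)" if w: "w \<in> ball 0 R" for w
    proof -
      have "(Q has_field_derivative h1 w * (exp (- w - L w) * (- 1 - (p w - 1))) + h2 w * exp (- w - L w)) (at w)"
        unfolding Q_def
        by (rule derivative_eq_intros dh1[OF w] L[OF w] refl)+ (simp add: algebra_simps)
      moreover have "h1 w * (exp (- w - L w) * (- 1 - (p w - 1))) + h2 w * exp (- w - L w) = 0"
        using nz[OF w] by (simp add: p_def field_simps)
      ultimately show ?thesis by (simp add: has_field_derivative_at_within)
    qed
    then obtain q where "\<And>w. w \<in> ball 0 R \<Longrightarrow> Q w = q"
      using has_field_derivative_zero_constant[OF convex_ball] by metis
    then have "Q z = Q 0" using z R' by simp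
    then have "h1 z * exp (- z - L z) = 1" using init by (simp add: Q_def L_def)
    then have "h1 z * exp (- z - L z) * (exp z * exp (L z)) = exp z * exp (L z)" by simp
    moreover have "exp (- z - L z) * (exp z * exp (L z)) = 1"
      by (simp flip: exp_add)
    ultimately show ?thesis by (simp add: mult.assoc)
  qed
  have ez: "cmod (exp z) \<le> exp 9" if "z \<in> cball 0 9" for z :: complex
    by (rule order_trans[OF norm_exp]) (use that in simp)
  have h1e: "cmod (h1 z - exp z) \<le> 18 * exp 9 * \<epsilon>" if z: "z \<in> cball 0 9" for z
  proof -
    have "h1 z - exp z = exp z * (exp (L z) - 1)"
      using q[of z] z sub by (auto simp: algebra_simps)
    then have "cmod (h1 z - exp z) = cmod (exp z) * cmod (exp (L z) - 1)"
      by (simp add: norm_mult)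
    also have "cmod (exp (L z) - 1) \<le> 2 * cmod (L z)"
    proof -
      have "cmod (L z) \<le> 1 / 2" using Lb[OF z] \<epsilon>0 by linarith
      then show ?thesis using norm_exp_bounds(2)[of "L z"] norm_ge_zero[of "L z"] by linarith
    qed
    also have "\<dots> \<le> 18 * \<epsilon>" using Lb[OF z] by simp
    also have "cmod (exp z) * (18 * \<epsilon>) \<le> exp 9 * (18 * \<epsilon>)"
      using ez[OF z] \<epsilon>0 by (intro mult_right_mono) auto
    finally show ?thesis by (simp add: mult_left_mono algebra_simps)
  qed
  have hE: "cmod ((h z - exp z) - (h 0 - exp 0)) \<le> 162 * exp 9 * \<epsilon>" if z: "z \<in> cball 0 9" for z
  proof -
    have "cmod ((h z - exp z) - (h 0 - exp 0)) \<le> 18 * exp 9 * \<epsilon> * cmod (z - 0)"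
    proof (rule field_differentiable_bound[where S = "cball 0 9" and f' = "\<lambda>z. h1 z - exp z"])
      fix w :: complex assume "w \<in> cball 0 9"
      then have w: "w \<in> ball 0 R" using sub by blast
      show "((\<lambda>z. h z - exp z) has_field_derivative h1 w - exp w) (at w within cball 0 9)"
        by (rule has_field_derivative_at_within, intro DERIV_diff DERIV_exp dh[OF w])
    qed (use h1e z in auto)
    also have "\<dots> \<le> 18 * exp 9 * \<epsilon> * 9" using z \<epsilon>0 by (intro mult_left_mono) auto
    finally show ?thesis by simp
  qed
  have g1e: "cmod (g1 z - \<omega> 0 * exp z) \<le> 20 * exp 9 * \<epsilon>" if z: "z \<in> cball 0 9" for z
  proof -
    have zR: "z \<in> ball 0 R" using z sub by blast
    have "g1 z - \<omega> 0 * exp z = (\<omega> z - \<omega> 0) * h1 z + \<omega> 0 * (h1 z - exp z)"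
    proof -
      have "g1 z = \<omega> z * h1 z" using nz[OF zR] by (simp add: \<omega>_def)
      then show ?thesis by (simp add: algebra_simps)
    qed
    then have "cmod (g1 z - \<omega> 0 * exp z) \<le> cmod (\<omega> z - \<omega> 0) * cmod (h1 z) + cmod (\<omega> 0) * cmod (h1 z - exp z)"
      by (metis norm_mult norm_triangle_ineq)
    also have "\<dots> \<le> \<epsilon> * (2 * exp 9) + 1 * (18 * exp 9 * \<epsilon>)"
    proof (intro add_mono mult_mono)
      have "cmod (h1 z) \<le> cmod (exp z) + cmod (h1 z - exp z)" by (rule norm_triangle_sub)
      also have "\<dots> \<le> exp 9 + exp 9 * (18 * \<epsilon>)" using ez[OF z] h1e[OF z] by (intro add_mono) (simp_all only: mult_ac)
      also have "\<dots> \<le> exp 9 + exp 9 * 1" using \<epsilon>0 by (intro add_left_mono mult_left_mono) auto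
      finally show "cmod (h1 z) \<le> 2 * exp 9" by simp
      have "cmod (\<omega> 0) \<le> k" using \<omega>b[of 0] R' by auto
      then show "cmod (\<omega> 0) \<le> 1" using k by simp
    qed (use \<omega>1[OF z] h1e[OF z] \<epsilon>0 in auto)
    finally show ?thesis by (simp add: mult_ac)
  qed
  have gE: "cmod ((g z - \<omega> 0 * exp z) - (g 0 - \<omega> 0 * exp 0)) \<le> 180 * exp 9 * \<epsilon>" if z: "z \<in> cball 0 9" for z
  proof -
    have "cmod ((g z - \<omega> 0 * exp z) - (g 0 - \<omega> 0 * exp 0)) \<le> 20 * exp 9 * \<epsilon> * cmod (z - 0)"
    proof (rule field_differentiable_bound[where S = "cball 0 9" and f' = "\<lambda>z. g1 z - \<omega> 0 * exp z"])
      fix w :: complex assume "w \<in> cball 0 9"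
      then have w: "w \<in> ball 0 R" using sub by blast
      show "((\<lambda>z. g z - \<omega> 0 * exp z) has_field_derivative g1 w - \<omega> 0 * exp w) (at w within cball 0 9)"
        by (rule has_field_derivative_at_within, intro DERIV_diff DERIV_cmult DERIV_exp dg[OF w])
    qed (use g1e z in auto)
    also have "\<dots> \<le> 20 * exp 9 * \<epsilon> * 9" using z \<epsilon>0 by (intro mult_left_mono) auto
    finally show ?thesis by simp
  qed
  \<comment> \<open>The additive constants left over by the two integrations; subtracting them does
    not affect injectivity.\<close>
  define C where "C = h 0 - 1 + cnj (g 0 - \<omega> 0)"
  have "\<not> inj_on (\<lambda>z. h z + cnj (g z) - C) (cball 0 9)"
  proof (rule affine_exp_perturbation_not_inj[where b = "\<omega> 0" and k = k])
    show "continuous_on (cball 0 9) (\<lambda>z. h z + cnj (g z) - C)"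
      using h1hol sub by (intro continuous_intros)
        (meson holomorphic_on_imp_continuous_on holomorphic_on_subset)+
    show "cmod (\<omega> 0) \<le> k" using \<omega>b[of 0] R' by auto
    fix z :: complex assume z: "z \<in> cball 0 9"
    have "h z + cnj (g z) - C - (exp z + cnj (\<omega> 0 * exp z))
       = ((h z - exp z) - (h 0 - exp 0)) + cnj ((g z - \<omega> 0 * exp z) - (g 0 - \<omega> 0 * exp 0))"
      by (simp add: C_def algebra_simps)
    also have "cmod \<dots> \<le> 162 * exp 9 * \<epsilon> + 180 * exp 9 * \<epsilon>"
      by (rule order_trans[OF norm_triangle_ineq add_mono])
        (use hE[OF z] gE[OF z] in \<open>simp_all only: complex_mod_cnj\<close>)
    also have "\<dots> \<le> (1 - k) / 4" using \<epsilon> by (simp add: mult_ac)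
    finally show "cmod (h z + cnj (g z) - C - (exp z + cnj (\<omega> 0 * exp z))) \<le> (1 - k) / 4" .
  qed (use k in auto)
  moreover have "inj_on (\<lambda>z. h z + cnj (g z) - C) (cball 0 9)" if "inj_on (\<lambda>z. h z + cnj (g z)) (ball 0 R)"
    using inj_on_subset[OF that sub] by (simp add: inj_on_def)
  ultimately show ?thesis by blast
qed

text \<open>Let u = h''/h'. The weight 1/2 - cmod z vanishes on the circle of radius 1/2, so a
  positive maximum of its product with |u| lies at an interior point z0, where the weight is s.
  Within s/2 of z0 the weight is still at least s/2, hence |u| at most doubles there. After zooming
  this is the growth hypothesis \<open>h2\<close> of
  \<open>near_exponential_not_inj\<close>.\<close>

lemma univalent_harmonic_second_derivative_bound:
  fixes h g :: "complex \<Rightarrow> complex"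
  assumes h: "h holomorphic_on unit_disk" and g: "g holomorphic_on unit_disk"
    and nz: "\<And>z. z \<in> unit_disk \<Longrightarrow> deriv h z \<noteq> 0"
    and gb: "\<And>z. z \<in> unit_disk \<Longrightarrow> cmod (deriv g z) \<le> k * cmod (deriv h z)"
    and k: "0 \<le> k" "k < 1" and inj: "inj_on (\<lambda>z. h z + cnj (g z)) unit_disk"
  shows "cmod (deriv (deriv h) 0 / deriv h 0) \<le> 200000 * exp 9 / (1 - k)"
proof (rule ccontr)
  define u where "u = (\<lambda>z. deriv (deriv h) z / deriv h z)"
  define M where "M = 50000 * exp 9 / (1 - k)"
  assume "\<not> ?thesis"
  \<comment> \<open>At the origin the weight is 1/2, so s |u(z0)| exceeds 2 M and the rescaled disk
    has radius R > M; this is the source of the factor 4.\<close>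
  then have u0: "cmod (u 0) > 4 * M" by (simp add: u_def M_def)
  have M: "M > 0" using k by (simp add: M_def)
  have hol: "deriv h holomorphic_on unit_disk" "deriv (deriv h) holomorphic_on unit_disk"
    by (intro holomorphic_deriv h open_ball)+
  have "u holomorphic_on unit_disk"
    unfolding u_def by (rule holomorphic_on_divide[OF hol(2,1) nz])
  then have "continuous_on (cball 0 (1 / 2)) u"
    by (rule holomorphic_on_imp_continuous_on[OF holomorphic_on_subset]) auto
  then have cont: "continuous_on (cball 0 (1 / 2)) (\<lambda>z. (1 / 2 - cmod z) * cmod (u z))"
    by (intro continuous_on_mult continuous_on_diff continuous_on_const continuous_on_norm continuous_on_id)
  obtain z0 where z0: "z0 \<in> cball 0 (1 / 2)"
    and max: "\<And>z. z \<in> cball 0 (1 / 2) \<Longrightarrow> (1 / 2 - cmod z) * cmod (u z) \<le> (1 / 2 - cmod z0) * cmod (u z0)"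
    using continuous_attains_sup[OF compact_cball _ cont] by auto
  define s where "s = 1 / 2 - cmod z0"
  have big: "2 * M < s * cmod (u z0)"
    using max[of 0] u0 by (simp add: s_def)
  have s: "s > 0" and uz0: "u z0 \<noteq> 0"
  proof -
    show "u z0 \<noteq> 0" using big M by auto
    then show "s > 0" using big M by (smt (verit) mult_nonpos_nonneg norm_ge_zero)
  qed
  define R where "R = s * cmod (u z0) / 2"
  have RM: "R \<ge> M" using big by (simp add: R_def)
  \<comment> \<open>With step \<open>a\<close> and factor \<open>c\<close>, the rescaled analytic
    part has first and second derivative 1 at the origin. The factor \<open>cnj c\<close> on g makes
    the whole map c times the mapping composed with \<open>P\<close>, so it stays injective.\<close>
  define a where "a = 1 / u z0"
  define P where "P = (\<lambda>\<zeta>. z0 + a * \<zeta>)"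
  define c where "c = u z0 / deriv h z0"
  have P0: "P 0 = z0" by (simp add: P_def)
  have Pdist: "cmod (P \<zeta> - z0) < s / 2" if "\<zeta> \<in> ball 0 R" for \<zeta>
  proof -
    have "cmod (P \<zeta> - z0) = cmod \<zeta> / cmod (u z0)" by (simp add: P_def a_def norm_divide norm_mult)
    also have "\<dots> < R / cmod (u z0)" using that uz0 by (intro divide_strict_right_mono) auto
    also have "\<dots> = s / 2" using uz0 by (simp add: R_def)
    finally show ?thesis .
  qed
  have Pn: "cmod (P \<zeta>) < 1 / 2 - s / 2" if "\<zeta> \<in> ball 0 R" for \<zeta>
    using Pdist[OF that] norm_triangle_sub[of "P \<zeta>" z0] by (simp add: s_def field_simps)
  have Pin: "P \<zeta> \<in> unit_disk" if "\<zeta> \<in> ball 0 R" for \<zeta>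
    using Pn[OF that] s by simp
  have z0d: "z0 \<in> unit_disk" using z0 by auto
  have ub: "cmod (u (P \<zeta>)) \<le> 2 * cmod (u z0)" if "\<zeta> \<in> ball 0 R" for \<zeta>
  proof -
    have "(s / 2) * cmod (u (P \<zeta>)) \<le> (1 / 2 - cmod (P \<zeta>)) * cmod (u (P \<zeta>))"
      using Pn[OF that] by (intro mult_right_mono) auto
    also have "\<dots> \<le> s * cmod (u z0)"
      using max[of "P \<zeta>"] Pn[OF that] s by (simp add: s_def)
    finally show ?thesis using s by simp
  qed
  have dP: "(P has_field_derivative a) (at \<zeta>)" for \<zeta>
    unfolding P_def by (auto intro!: derivative_eq_intros)
  have ac: "a \<noteq> 0" "c \<noteq> 0" "deriv h z0 \<noteq> 0" "c * a = 1 / deriv h z0"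
    using uz0 nz[OF z0d] by (auto simp: a_def c_def)
  have "\<not> inj_on (\<lambda>\<zeta>. c * h (P \<zeta>) + cnj (cnj c * g (P \<zeta>))) (ball 0 R)"
  proof (rule near_exponential_not_inj[where ?h1.0 = "\<lambda>\<zeta>. c * (deriv h (P \<zeta>) * a)"
        and ?h2.0 = "\<lambda>\<zeta>. c * (deriv (deriv h) (P \<zeta>) * a * a)"
        and ?g1.0 = "\<lambda>\<zeta>. cnj c * (deriv g (P \<zeta>) * a)" and k = k])
    fix \<zeta> :: complex assume \<zeta>: "\<zeta> \<in> ball 0 R"
    note D = holomorphic_derivI[OF _ open_ball Pin[OF \<zeta>]]
    show "((\<lambda>\<zeta>. c * h (P \<zeta>)) has_field_derivative c * (deriv h (P \<zeta>) * a)) (at \<zeta>)"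
      by (intro DERIV_cmult DERIV_chain2[OF D dP] h)
    show "((\<lambda>\<zeta>. cnj c * g (P \<zeta>)) has_field_derivative cnj c * (deriv g (P \<zeta>) * a)) (at \<zeta>)"
      by (intro DERIV_cmult DERIV_chain2[OF D dP] g)
    show "((\<lambda>\<zeta>. c * (deriv h (P \<zeta>) * a)) has_field_derivative c * (deriv (deriv h) (P \<zeta>) * a * a)) (at \<zeta>)"
      by (intro DERIV_cmult DERIV_cmult_right DERIV_chain2[OF D dP] hol)
    show "c * (deriv h (P \<zeta>) * a) \<noteq> 0" using nz[OF Pin[OF \<zeta>]] ac by simp
    have "cmod (deriv (deriv h) (P \<zeta>)) = cmod (u (P \<zeta>)) * cmod (deriv h (P \<zeta>))"
      using nz[OF Pin[OF \<zeta>]] by (simp add: u_def norm_divide)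
    also have "\<dots> \<le> 2 * cmod (u z0) * cmod (deriv h (P \<zeta>))"
      using ub[OF \<zeta>] by (intro mult_right_mono) auto
    finally have "cmod (deriv (deriv h) (P \<zeta>)) * cmod a \<le> 2 * cmod (u z0) * cmod (deriv h (P \<zeta>)) * cmod a"
      by (intro mult_right_mono) auto
    also have "\<dots> = 2 * cmod (deriv h (P \<zeta>))" using uz0 by (simp add: a_def norm_divide)
    finally show "cmod (c * (deriv (deriv h) (P \<zeta>) * a * a)) \<le> 2 * cmod (c * (deriv h (P \<zeta>) * a))"
      using ac by (simp add: norm_mult)
    show "cmod (cnj c * (deriv g (P \<zeta>) * a)) \<le> k * cmod (c * (deriv h (P \<zeta>) * a))"
      using gb[OF Pin[OF \<zeta>]] ac by (simp add: norm_mult)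
  next
    show "c * (deriv h (P 0) * a) = 1"
      using ac uz0 unfolding P0 by (simp add: c_def a_def)
    show "c * (deriv (deriv h) (P 0) * a * a) = 1"
      using ac uz0 unfolding P0 by (simp add: c_def a_def u_def)
  qed (use k RM M_def in auto)
  moreover have "inj_on (\<lambda>\<zeta>. c * h (P \<zeta>) + cnj (cnj c * g (P \<zeta>))) (ball 0 R)"
  proof (rule inj_onI)
    fix x y assume xy: "x \<in> ball 0 R" "y \<in> ball 0 R"
      and "c * h (P x) + cnj (cnj c * g (P x)) = c * h (P y) + cnj (cnj c * g (P y))"
    then have "c * (h (P x) + cnj (g (P x))) = c * (h (P y) + cnj (g (P y)))"
      by (simp add: algebra_simps)
    then have "P x = P y"
      using ac inj_onD[OF inj _ Pin Pin] xy by auto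
    then show "x = y" using ac by (simp add: P_def)
  qed
  ultimately show False by blast
qed

section \<open>Hyperbolic circumcenters\<close>

text \<open>This is cosh^2 of half the hyperbolic distance. It increases with the distance and is
  rational in the real coordinates, so it can replace \<open>hyp_dist\<close> in
  comparisons.\<close>

definition hyp_cosh2 :: "complex \<Rightarrow> complex \<Rightarrow> real" where
  "hyp_cosh2 c z = (cmod (1 - cnj c * z))\<^sup>2 / ((1 - (cmod c)\<^sup>2) * (1 - (cmod z)\<^sup>2))"

lemma disk_defect_pos: "z \<in> unit_disk \<Longrightarrow> 0 < 1 - (cmod z)\<^sup>2"
  by (simp add: abs_square_less_1)

lemma disk_identity:
  "(cmod (1 - cnj c * z))\<^sup>2 - (cmod (c - z))\<^sup>2 = (1 - (cmod c)\<^sup>2) * (1 - (cmod z)\<^sup>2)"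
  unfolding cmod_power2 by (simp add: power2_eq_square algebra_simps)

lemma disk_denominator_nonzero: "c \<in> unit_disk \<Longrightarrow> z \<in> unit_disk \<Longrightarrow> 1 - cnj c * z \<noteq> 0"
  by (metis disk_defect_pos disk_identity diff_ge_0_iff_ge less_le_not_le mult_pos_pos norm_zero
      power_zero_numeral diff_0 neg_le_0_iff_le zero_le_power2 not_less)

lemma hyp_cosh2_eq:
  assumes "c \<in> unit_disk" "z \<in> unit_disk"
  shows "hyp_cosh2 c z = 1 + (cmod (c - z))\<^sup>2 / ((1 - (cmod c)\<^sup>2) * (1 - (cmod z)\<^sup>2))"
proof -
  have "(1 - (cmod c)\<^sup>2) * (1 - (cmod z)\<^sup>2) \<noteq> 0"
    using assms[THEN disk_defect_pos] by simp
  moreover have "(cmod (1 - cnj c * z))\<^sup>2 = (1 - (cmod c)\<^sup>2) * (1 - (cmod z)\<^sup>2) + (cmod (c - z))\<^sup>2"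
    using disk_identity[of c z] by linarith
  ultimately show ?thesis unfolding hyp_cosh2_def by (simp only: add_divide_distrib) simp
qed

lemma hyp_cosh2_ge_1: "c \<in> unit_disk \<Longrightarrow> z \<in> unit_disk \<Longrightarrow> 1 \<le> hyp_cosh2 c z"
  using disk_defect_pos[of c] disk_defect_pos[of z] by (simp add: hyp_cosh2_eq)

lemma tanh_artanh_real:
  assumes "\<bar>x :: real\<bar> < 1"
  shows "tanh (artanh x) = x"
proof -
  have pos: "(1 + x) / (1 - x) > 0" using assms by simp
  have "- (2 * artanh x) = ln (inverse ((1 + x) / (1 - x)))"
    using pos by (simp only: ln_inverse) (simp add: artanh_def)
  then have "exp (- (2 * artanh x)) = (1 - x) / (1 + x)"
    using pos by (simp only: exp_ln inverse_positive_iff_positive) simp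
  then have "tanh (artanh x) = (1 - (1 - x) / (1 + x)) / (1 + (1 - x) / (1 + x))"
    by (simp add: tanh_real_altdef)
  also have "\<dots> = x" using assms by (simp add: divide_simps)
  finally show ?thesis .
qed

lemma hyp_dist_props:
  assumes c: "c \<in> unit_disk" and z: "z \<in> unit_disk"
  shows hyp_dist_nonneg: "0 \<le> hyp_dist c z"
    and cosh_half_hyp_dist: "(cosh (hyp_dist c z / 2))\<^sup>2 = hyp_cosh2 c z"
proof -
  define t where "t = cmod ((c - z) / (1 - cnj z * c))"
  have nz: "1 - cnj z * c \<noteq> 0" using disk_denominator_nonzero[OF z c] .
  have sw: "cmod (1 - cnj z * c) = cmod (1 - cnj c * z)"
    by (metis complex_cnj_cnj complex_cnj_diff complex_cnj_mult complex_cnj_one complex_mod_cnj mult.commute)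
  define n where "n = (cmod (1 - cnj c * z))\<^sup>2"
  have n: "n > 0" using disk_denominator_nonzero[OF c z] by (simp add: n_def)
  have t2: "1 - t\<^sup>2 = (1 - (cmod c)\<^sup>2) * (1 - (cmod z)\<^sup>2) / n"
    using disk_identity[of c z] n unfolding t_def norm_divide sw power_divide
    by (simp add: n_def field_simps)
  have pos: "1 - t\<^sup>2 > 0"
    unfolding t2 using disk_defect_pos[OF c] disk_defect_pos[OF z] n by simp
  have t: "0 \<le> t" "t < 1" using pos by (auto simp: t_def power_less_one_iff)
  define y where "y = artanh t"
  have ty: "tanh y = t" unfolding y_def using t by (intro tanh_artanh_real) auto
  have hd: "hyp_dist c z = 2 * y" by (simp add: hyp_dist_def t_def y_def)
  show "0 \<le> hyp_dist c z"
    unfolding hd using t ty by (metis mult_nonneg_nonneg tanh_real_nonneg_iff zero_le_numeral)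
  have "sinh y = t * cosh y" using ty[symmetric] by (simp add: tanh_def)
  then have "(cosh y)\<^sup>2 * (1 - t\<^sup>2) = 1"
    using cosh_square_eq[of y] by (simp add: algebra_simps power_mult_distrib)
  then have "(cosh y)\<^sup>2 = 1 / (1 - t\<^sup>2)" using pos by (simp add: eq_divide_eq)
  then show "(cosh (hyp_dist c z / 2))\<^sup>2 = hyp_cosh2 c z"
    unfolding hd t2 hyp_cosh2_def n_def[symmetric] by simp
qed

lemma cosh_half_le_iff:
  "0 \<le> x \<Longrightarrow> 0 \<le> y \<Longrightarrow> (cosh (x / 2))\<^sup>2 \<le> (cosh (y / 2))\<^sup>2 \<longleftrightarrow> x \<le> (y::real)"
  by (simp add: cosh_real_nonneg_le_iff)

lemma hyp_dist_le_iff: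
  assumes "c \<in> unit_disk" "z \<in> unit_disk" "0 \<le> r"
  shows "hyp_dist c z \<le> r \<longleftrightarrow> hyp_cosh2 c z \<le> (cosh (r / 2))\<^sup>2"
  using cosh_half_le_iff[OF hyp_dist_nonneg] cosh_half_hyp_dist assms by metis

lemma hyp_dist_eqI:
  assumes "c \<in> unit_disk" "z \<in> unit_disk" "c' \<in> unit_disk" "z' \<in> unit_disk"
    and "hyp_cosh2 c z = hyp_cosh2 c' z'"
  shows "hyp_dist c z = hyp_dist c' z'"
  using assms hyp_dist_le_iff hyp_dist_nonneg cosh_half_hyp_dist by (metis order_antisym order_refl)

lemma cosh2_radius:
  assumes "1 \<le> (M::real)"
  obtains r where "0 \<le> r" "(cosh (r / 2))\<^sup>2 = M"
proof
  show "0 \<le> 2 * arcosh (sqrt M)" using assms by simp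
  show "(cosh (2 * arcosh (sqrt M) / 2))\<^sup>2 = M" using assms by (simp add: cosh_arcosh_real)
qed

lemma compact_disk_bound:
  assumes "compact E" "E \<noteq> {}" "E \<subseteq> unit_disk"
  obtains \<rho> e where "e \<in> E" "cmod e = \<rho>" "0 \<le> \<rho>" "\<rho> < 1" "\<And>z. z \<in> E \<Longrightarrow> cmod z \<le> \<rho>"
proof -
  obtain e where "e \<in> E" "\<And>z. z \<in> E \<Longrightarrow> cmod z \<le> cmod e"
    using continuous_attains_sup[OF assms(1,2) continuous_on_norm_id] by auto
  with assms(3) show thesis by (intro that[of e "cmod e"]) auto
qed

lemma hyp_cosh2_le:
  assumes c: "cmod c \<le> \<rho>" and z: "cmod z \<le> \<sigma>" and "\<rho> < 1" "\<sigma> < 1"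
  shows "hyp_cosh2 c z \<le> 4 / ((1 - \<rho>\<^sup>2) * (1 - \<sigma>\<^sup>2))"
  unfolding hyp_cosh2_def
proof (rule frac_le)
  have 0: "0 \<le> \<rho>" "0 \<le> \<sigma>" using c z norm_ge_zero order_trans by blast+
  have "cmod (1 - cnj c * z) \<le> 1 + cmod c * cmod z"
    using norm_triangle_ineq4[of 1 "cnj c * z"] by (simp add: norm_mult)
  also have "\<dots> \<le> 1 + 1 * 1" using assms 0 by (intro add_left_mono mult_mono) auto
  finally have "(cmod (1 - cnj c * z))\<^sup>2 \<le> 2\<^sup>2" by (intro power_mono) auto
  then show "(cmod (1 - cnj c * z))\<^sup>2 \<le> 4" by simp
  have p: "0 < 1 - \<rho>\<^sup>2" "0 < 1 - \<sigma>\<^sup>2" using assms 0 by (auto simp: abs_square_less_1)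
  then show "0 < (1 - \<rho>\<^sup>2) * (1 - \<sigma>\<^sup>2)" by simp
  have "(cmod c)\<^sup>2 \<le> \<rho>\<^sup>2" "(cmod z)\<^sup>2 \<le> \<sigma>\<^sup>2" using c z by (auto intro: power_mono)
  then show "(1 - \<rho>\<^sup>2) * (1 - \<sigma>\<^sup>2) \<le> (1 - (cmod c)\<^sup>2) * (1 - (cmod z)\<^sup>2)"
    using p by (intro mult_mono) auto
qed simp_all

definition hyp_radius :: "complex set \<Rightarrow> complex \<Rightarrow> real" where
  "hyp_radius E c = (SUP \<zeta>\<in>E. hyp_dist c \<zeta>)"

lemma hyp_dist_le_common_bound:
  assumes "\<rho> < 1" "\<sigma> < 1"
  obtains B where "\<And>c z. cmod c \<le> \<rho> \<Longrightarrow> cmod z \<le> \<sigma> \<Longrightarrow> hyp_dist c z \<le> B"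
proof -
  define M where "M = max 1 (4 / ((1 - \<rho>\<^sup>2) * (1 - \<sigma>\<^sup>2)))"
  obtain r where r: "0 \<le> r" "(cosh (r / 2))\<^sup>2 = M" using cosh2_radius[of M] by (auto simp: M_def)
  show thesis
  proof (rule that[of r])
    fix c z assume cz: "cmod c \<le> \<rho>" "cmod z \<le> \<sigma>"
    have "hyp_cosh2 c z \<le> M" using hyp_cosh2_le[OF cz assms] by (simp add: M_def)
    then show "hyp_dist c z \<le> r"
      using hyp_dist_le_iff[of c z r] cz assms r by simp
  qed
qed

text \<open>A real \<open>SUP\<close> carries no information for unbounded sets. A compact set
  inside the open disk stays away from the circle, which bounds all distances.\<close>

lemma bdd_above_hyp_dist:
  assumes "compact E" "E \<subseteq> unit_disk" "c \<in> unit_disk"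
  shows "bdd_above (hyp_dist c ` E)"
proof (cases "E = {}")
  case False
  obtain \<rho> e where \<rho>: "\<rho> < 1" "\<And>z. z \<in> E \<Longrightarrow> cmod z \<le> \<rho>"
    using compact_disk_bound[OF assms(1) False assms(2)] by metis
  have "cmod c < 1" using assms by simp
  then obtain B where "\<And>c' z. cmod c' \<le> cmod c \<Longrightarrow> cmod z \<le> \<rho> \<Longrightarrow> hyp_dist c' z \<le> B"
    using hyp_dist_le_common_bound[OF _ \<rho>(1)] by metis
  then show ?thesis using \<rho>(2) by (intro bdd_aboveI[of _ B]) auto
qed simp

section \<open>Existence and uniqueness of circumcenters\<close>

locale compact_disk_set =
  fixes E :: "complex set"
  assumes compact: "compact E" and nonempty: "E \<noteq> {}" and subset: "E \<subseteq> unit_disk"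
begin

lemma hyp_dist_le_radius: "c \<in> unit_disk \<Longrightarrow> \<zeta> \<in> E \<Longrightarrow> hyp_dist c \<zeta> \<le> hyp_radius E c"
  unfolding hyp_radius_def by (rule cSUP_upper[OF _ bdd_above_hyp_dist[OF compact subset]])

lemma hyp_radius_nonneg:
  assumes "c \<in> unit_disk" shows "0 \<le> hyp_radius E c"
proof -
  obtain \<zeta> where "\<zeta> \<in> E" using nonempty by blast
  then show ?thesis using hyp_dist_nonneg[OF assms] hyp_dist_le_radius[OF assms] subset
    by (meson order_trans subsetD)
qed

lemma hyp_cosh2_le_radius:
  "c \<in> unit_disk \<Longrightarrow> \<zeta> \<in> E \<Longrightarrow> hyp_cosh2 c \<zeta> \<le> (cosh (hyp_radius E c / 2))\<^sup>2"
  using hyp_dist_le_iff[of c \<zeta> "hyp_radius E c"] hyp_dist_le_radius hyp_radius_nonneg subset by blast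

lemma hyp_radius_leI:
  assumes "c \<in> unit_disk" "0 \<le> r" "\<And>\<zeta>. \<zeta> \<in> E \<Longrightarrow> hyp_cosh2 c \<zeta> \<le> (cosh (r / 2))\<^sup>2"
  shows "hyp_radius E c \<le> r"
  unfolding hyp_radius_def
  using assms hyp_dist_le_iff subset by (intro cSUP_least nonempty) blast

text \<open>Pointwise strict inequalities could be lost in the supremum, so a single M strictly
  below the target is demanded.\<close>

lemma hyp_radius_less:
  assumes c: "c \<in> unit_disk" and r: "0 \<le> r"
    and M: "\<And>\<zeta>. \<zeta> \<in> E \<Longrightarrow> hyp_cosh2 c \<zeta> \<le> M" "M < (cosh (r / 2))\<^sup>2"
  shows "hyp_radius E c < r"
proof -
  obtain \<zeta> where "\<zeta> \<in> E" using nonempty by blast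
  then have "1 \<le> M" using M(1) hyp_cosh2_ge_1[OF c] subset by (meson order_trans subsetD)
  then obtain r' where r': "0 \<le> r'" "(cosh (r' / 2))\<^sup>2 = M" using cosh2_radius by blast
  have "hyp_radius E c \<le> r'" using hyp_radius_leI[OF c r'(1)] M(1) r'(2) by simp
  also have "r' < r" using cosh_half_le_iff[OF r r'(1)] M(2) r'(2) by auto
  finally show ?thesis .
qed

definition is_circumcenter :: "complex \<Rightarrow> bool" where
  "is_circumcenter c \<longleftrightarrow> c \<in> unit_disk \<and> (\<forall>c'\<in>unit_disk. hyp_radius E c \<le> hyp_radius E c')"

lemma circumcenter_exists: "\<exists>c. is_circumcenter c"
proof -
  define m where "m = (INF c\<in>unit_disk. hyp_radius E c)"
  have bdd: "bdd_below (hyp_radius E ` unit_disk)"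
    using hyp_radius_nonneg by (intro bdd_belowI[of _ 0]) auto
  have m0: "0 \<le> m" unfolding m_def using hyp_radius_nonneg by (intro cINF_greatest) auto
  define r where "r = (\<lambda>n::nat. m + 1 / real (Suc n))"
  have r0: "0 \<le> r n" for n using m0 by (simp add: r_def)
  \<comment> \<open>The sublevel condition for the radius \<open>r n\<close> is multiplied out, so
    that it is closed and makes sense on the closed disk, where the nested compact sets have a
    common point.\<close>
  define S where "S = (\<lambda>n. cball 0 1 \<inter> (\<Inter>\<zeta>\<in>E. {c.
      (cmod (1 - cnj c * \<zeta>))\<^sup>2 \<le> (cosh (r n / 2))\<^sup>2 * ((1 - (cmod c)\<^sup>2) * (1 - (cmod \<zeta>)\<^sup>2))}))"
  have iff: "hyp_cosh2 c \<zeta> \<le> s \<longleftrightarrow> (cmod (1 - cnj c * \<zeta>))\<^sup>2 \<le> s * ((1 - (cmod c)\<^sup>2) * (1 - (cmod \<zeta>)\<^sup>2))"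
    if "c \<in> unit_disk" "\<zeta> \<in> E" for c \<zeta> s
    unfolding hyp_cosh2_def
    using disk_defect_pos[of c] disk_defect_pos[of \<zeta>] that subset by (intro pos_divide_le_eq mult_pos_pos) auto
  obtain a where a: "\<And>n. a \<in> S n"
  proof (rule bounded_closed_nest[of S])
    show "closed (S n)" for n
      unfolding S_def by (intro closed_Int closed_INT closed_Collect_le continuous_intros closed_cball ballI)
    show "S n \<noteq> {}" for n
    proof -
      have "m < r n" by (simp add: r_def)
      then obtain c where c: "c \<in> unit_disk" "hyp_radius E c < r n"
        unfolding m_def using cINF_less_iff[OF _ bdd] by (metis centre_in_ball empty_iff zero_less_one)
      have "c \<in> S n"
        unfolding S_def
      proof (intro IntI INT_I CollectI)
        show "c \<in> cball 0 1" using c by simp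
        fix \<zeta> assume \<zeta>: "\<zeta> \<in> E"
        have "hyp_cosh2 c \<zeta> \<le> (cosh (r n / 2))\<^sup>2"
          using hyp_dist_le_iff[of c \<zeta> "r n"] hyp_dist_le_radius[OF c(1) \<zeta>] c r0 \<zeta> subset by fastforce
        then show "(cmod (1 - cnj c * \<zeta>))\<^sup>2 \<le> (cosh (r n / 2))\<^sup>2 * ((1 - (cmod c)\<^sup>2) * (1 - (cmod \<zeta>)\<^sup>2))"
          using iff[OF c(1) \<zeta>] by simp
      qed
      then show ?thesis by blast
    qed
    show "S n \<subseteq> S k" if "k \<le> n" for k n
    proof
      fix c assume c: "c \<in> S n"
      have "r n \<le> r k" using that by (simp add: r_def frac_le)
      then have ch: "(cosh (r n / 2))\<^sup>2 \<le> (cosh (r k / 2))\<^sup>2" using cosh_half_le_iff[OF r0 r0] by blast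
      show "c \<in> S k"
        unfolding S_def
      proof (intro IntI INT_I CollectI)
        show c1: "c \<in> cball 0 1" using c by (simp add: S_def)
        fix \<zeta> assume \<zeta>: "\<zeta> \<in> E"
        have "(cmod (1 - cnj c * \<zeta>))\<^sup>2 \<le> (cosh (r n / 2))\<^sup>2 * ((1 - (cmod c)\<^sup>2) * (1 - (cmod \<zeta>)\<^sup>2))"
          using c \<zeta> by (auto simp: S_def)
        also have "\<dots> \<le> (cosh (r k / 2))\<^sup>2 * ((1 - (cmod c)\<^sup>2) * (1 - (cmod \<zeta>)\<^sup>2))"
          using ch c1 \<zeta> disk_defect_pos[of \<zeta>] subset
          by (intro mult_right_mono mult_nonneg_nonneg) (auto simp: power_le_one)
        finally show "(cmod (1 - cnj c * \<zeta>))\<^sup>2 \<le> (cosh (r k / 2))\<^sup>2 * ((1 - (cmod c)\<^sup>2) * (1 - (cmod \<zeta>)\<^sup>2))" .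
      qed
    qed
    show "bounded (S 0)" unfolding S_def by (intro bounded_Int) simp
  qed blast
  \<comment> \<open>On the unit circle the right side of the condition vanishes, which forces cnj a
    * \<zeta> = 1 and so puts a point of E on the circle.\<close>
  have a1: "a \<in> unit_disk"
  proof (rule ccontr)
    assume "a \<notin> unit_disk"
    moreover have "cmod a \<le> 1" using a[of 0] by (simp add: S_def)
    ultimately have n1: "cmod a = 1" by simp
    obtain \<zeta> where \<zeta>: "\<zeta> \<in> E" using nonempty by blast
    then have "(cmod (1 - cnj a * \<zeta>))\<^sup>2 \<le> 0" using a[of 0] n1 by (auto simp: S_def)
    then have "cnj a * \<zeta> = 1" by simp
    then have "cmod \<zeta> = 1" using n1 by (metis complex_mod_cnj mult_1 norm_mult norm_one)
    then show False using \<zeta> subset by auto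
  qed
  have "hyp_radius E a \<le> r n" for n
  proof (rule hyp_radius_leI[OF a1 r0])
    fix \<zeta> assume "\<zeta> \<in> E"
    then show "hyp_cosh2 a \<zeta> \<le> (cosh (r n / 2))\<^sup>2"
      using a[of n] iff[OF a1] by (auto simp: S_def)
  qed
  moreover have "r \<longlonglongrightarrow> m"
    unfolding r_def using tendsto_add[OF tendsto_const lim_inverse_n'[THEN LIMSEQ_Suc]] by fastforce
  ultimately have "hyp_radius E a \<le> m"
    using LIMSEQ_le_const by blast
  then show ?thesis
    unfolding is_circumcenter_def m_def using a1 cINF_lower[OF bdd] order_trans by blast
qed

text \<open>Sublevel sets of \<open>c \<mapsto> hyp_cosh2 c \<zeta>\<close> are Euclidean disks, so the Euclidean midpoint of two
  distinct minimizers would be strictly better.\<close>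

lemma circumcenter_unique:
  assumes "is_circumcenter c1" "is_circumcenter c2"
  shows "c1 = c2"
proof (rule ccontr)
  assume ne: "c1 \<noteq> c2"
  have d: "c1 \<in> unit_disk" "c2 \<in> unit_disk" using assms by (auto simp: is_circumcenter_def)
  define m where "m = hyp_radius E c1"
  have m2: "hyp_radius E c2 = m"
    using assms by (auto simp: is_circumcenter_def m_def intro: order_antisym)
  have m0: "0 \<le> m" unfolding m_def by (rule hyp_radius_nonneg[OF d(1)])
  define s where "s = (cosh (m / 2))\<^sup>2"
  define \<delta> where "\<delta> = (cmod (c1 - c2))\<^sup>2 / 4"
  have \<delta>: "\<delta> > 0" using ne by (simp add: \<delta>_def)
  have s1: "s \<ge> 1" unfolding s_def by (simp add: cosh_real_ge_1)
  define c where "c = (c1 + c2) / 2"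
  have "cmod c \<le> (cmod c1 + cmod c2) / 2" unfolding c_def by (simp add: norm_divide norm_triangle_ineq)
  then have c: "c \<in> unit_disk" using d by simp
  have "hyp_radius E c < m"
  proof (rule hyp_radius_less[OF c m0])
    fix \<zeta> assume \<zeta>: "\<zeta> \<in> E"
    then have z: "\<zeta> \<in> unit_disk" using subset by blast
    define q where "q = 1 - (cmod \<zeta>)\<^sup>2"
    have q: "0 < q" "q \<le> 1" using disk_defect_pos[OF z] by (auto simp: q_def)
    define Q where "Q = (\<lambda>c. (cmod (1 - cnj c * \<zeta>))\<^sup>2 - s * ((1 - (cmod c)\<^sup>2) * q))"
    have Q: "Q c \<le> 0" if "c \<in> unit_disk" "hyp_radius E c = m" for c
    proof -
      have "hyp_cosh2 c \<zeta> \<le> s" using hyp_cosh2_le_radius[OF that(1) \<zeta>] that(2) by (simp add: s_def)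
      then show ?thesis
        using disk_defect_pos[OF that(1)] q by (simp add: Q_def hyp_cosh2_def q_def[symmetric] field_simps)
    qed
    \<comment> \<open>\<open>Q\<close> is a quadratic polynomial in the center, with coefficient
      |\<zeta>|^2 + s q at the squared norm. By the parallelogram law the midpoint gains exactly
      this coefficient times \<delta>.\<close>
    have "Q c = (Q c1 + Q c2) / 2 - ((cmod \<zeta>)\<^sup>2 + s * q) * \<delta>"
      unfolding Q_def c_def \<delta>_def cmod_power2
      by (simp add: power2_eq_square field_simps)
    also have "(cmod \<zeta>)\<^sup>2 + s * q \<ge> 1"
    proof -
      have "(cmod \<zeta>)\<^sup>2 = 1 - q" by (simp add: q_def)
      then show ?thesis using mult_right_mono[OF s1, of q] q by simp
    qed
    then have "((cmod \<zeta>)\<^sup>2 + s * q) * \<delta> \<ge> \<delta>" using \<delta> by simp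
    then have "(Q c1 + Q c2) / 2 - ((cmod \<zeta>)\<^sup>2 + s * q) * \<delta> \<le> - \<delta>"
      using Q[OF d(1) m_def[symmetric]] Q[OF d(2) m2] by argo
    finally have "(cmod (1 - cnj c * \<zeta>))\<^sup>2 \<le> s * ((1 - (cmod c)\<^sup>2) * q) - \<delta>"
      by (simp add: Q_def)
    \<comment> \<open>Since (1 - |c|^2) q is at most 1, the gain survives the division and yields
      the bound s - \<delta>, the same for all \<zeta>.\<close>
    also have "\<dots> \<le> (s - \<delta>) * ((1 - (cmod c)\<^sup>2) * q)"
    proof -
      have "(1 - (cmod c)\<^sup>2) * q \<le> 1 * 1" using q disk_defect_pos[OF c] by (intro mult_mono) auto
      then show ?thesis using \<delta> by (simp add: left_diff_distrib mult_left_le)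
    qed
    finally show "hyp_cosh2 c \<zeta> \<le> s - \<delta>"
      unfolding hyp_cosh2_def using disk_defect_pos[OF c] q by (simp add: q_def[symmetric] pos_divide_le_eq)
  next
    show "s - \<delta> < (cosh (m / 2))\<^sup>2" using \<delta> by (simp add: s_def)
  qed
  then show False using assms(1) c unfolding is_circumcenter_def m_def by (meson not_less)
qed

text \<open>Existence and uniqueness make the \<open>THE\<close> in \<open>circumcenter\<close>
  meaningful. The equivalence serves both to read off minimality and to identify a given point as
  the circumcenter.\<close>

lemma circumcenter_iff: "is_circumcenter c \<longleftrightarrow> circumcenter E = c"
proof -
  have eq: "circumcenter E = (THE c. is_circumcenter c)"
    unfolding circumcenter_def is_arg_min_linorder is_circumcenter_def hyp_radius_def
    by (simp add: Ball_def)
  have "\<exists>!c. is_circumcenter c" using circumcenter_exists circumcenter_unique by blast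
  then show ?thesis unfolding eq by (metis theI')
qed

lemma circumcenter_in_disk: "circumcenter E \<in> unit_disk"
  using circumcenter_iff is_circumcenter_def by blast

lemma bdd_above_hyp_dist_pairs: "bdd_above ((\<lambda>(z1, z2). hyp_dist z1 z2) ` (E \<times> E))"
proof -
  obtain \<rho> e where \<rho>: "\<rho> < 1" "\<And>z. z \<in> E \<Longrightarrow> cmod z \<le> \<rho>"
    using compact_disk_bound[OF compact nonempty subset] by metis
  obtain B where "\<And>c z. cmod c \<le> \<rho> \<Longrightarrow> cmod z \<le> \<rho> \<Longrightarrow> hyp_dist c z \<le> B"
    using hyp_dist_le_common_bound[OF \<rho>(1) \<rho>(1)] by metis
  then show ?thesis using \<rho>(2) by (intro bdd_aboveI[of _ B]) auto
qed

lemma hyp_dist_le_diameter: "z \<in> E \<Longrightarrow> w \<in> E \<Longrightarrow> hyp_dist z w \<le> hyp_diameter E"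
  unfolding hyp_diameter_def using cSUP_upper[OF _ bdd_above_hyp_dist_pairs, of "(z, w)"] by simp

lemma hyp_diameter_nonneg: "0 \<le> hyp_diameter E"
proof -
  obtain z where "z \<in> E" using nonempty by blast
  then show ?thesis
    using hyp_dist_le_diameter[of z z] hyp_dist_nonneg[of z z] subset by (meson order_trans subsetD)
qed

end

text \<open>If f = h + cnj g has dilatation w, this is the dilatation of a f + b cnj f + c: its
  analytic and coanalytic parts have derivatives a h' + b g' and cnj b h' + cnj a g'. For cmod b <
  cmod a it is an automorphism of the disk.\<close>

definition affine_moebius :: "complex \<Rightarrow> complex \<Rightarrow> complex \<Rightarrow> complex" where
  "affine_moebius a b w = (cnj b + cnj a * w) / (a + b * w)"

lemma affine_moebius_denominator:
  assumes "cmod b < cmod a" "cmod w \<le> 1"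
  shows "a + b * w \<noteq> 0"
proof
  assume "a + b * w = 0"
  then have "cmod a = cmod (b * w)" by (metis add_eq_0_iff norm_minus_cancel)
  also have "\<dots> \<le> cmod b" using assms by (simp add: norm_mult mult_left_le)
  finally show False using assms by simp
qed

lemma affine_moebius_identity:
  "(cmod (a + b * w))\<^sup>2 - (cmod (cnj b + cnj a * w))\<^sup>2 = ((cmod a)\<^sup>2 - (cmod b)\<^sup>2) * (1 - (cmod w)\<^sup>2)"
  unfolding cmod_power2 by (simp add: power2_eq_square algebra_simps)

lemma norm_square_diff_pos: "cmod b < cmod a \<Longrightarrow> 0 < (cmod a)\<^sup>2 - (cmod b)\<^sup>2"
  by (simp add: power_strict_mono)

lemma affine_moebius_defect:
  assumes ab: "cmod b < cmod a" and w: "w \<in> unit_disk"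
  shows "1 - (cmod (affine_moebius a b w))\<^sup>2
    = ((cmod a)\<^sup>2 - (cmod b)\<^sup>2) * (1 - (cmod w)\<^sup>2) / (cmod (a + b * w))\<^sup>2"
proof -
  have "a + b * w \<noteq> 0" using affine_moebius_denominator[OF ab] w by simp
  then show ?thesis
    unfolding affine_moebius_identity[symmetric] affine_moebius_def norm_divide power_divide
    by (simp add: diff_divide_distrib)
qed

lemma affine_moebius_in_disk:
  assumes ab: "cmod b < cmod a" and w: "w \<in> unit_disk"
  shows "affine_moebius a b w \<in> unit_disk"
proof -
  have "a + b * w \<noteq> 0" using affine_moebius_denominator[OF ab] w by simp
  then have "0 < 1 - (cmod (affine_moebius a b w))\<^sup>2"
    unfolding affine_moebius_defect[OF assms]
    using norm_square_diff_pos[OF ab] disk_defect_pos[OF w] by simp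
  then show ?thesis by (simp add: abs_square_less_1)
qed

lemma affine_moebius_inverse:
  assumes ab: "cmod b < cmod a" and w: "w \<in> unit_disk"
  shows "affine_moebius (cnj a) (- b) (affine_moebius a b w) = w"
proof -
  have nz: "a + b * w \<noteq> 0" using affine_moebius_denominator[OF ab] w by simp
  have nz2: "a * cnj a - b * cnj b \<noteq> 0"
    using norm_square_diff_pos[OF ab] unfolding complex_norm_square[symmetric]
    by (metis eq_iff_diff_eq_0 less_irrefl of_real_diff of_real_eq_0_iff of_real_power)
  define d where "d = a + b * w"
  have d: "d \<noteq> 0" using nz by (simp add: d_def)
  have "- cnj b + a * ((cnj b + cnj a * w) / d) = (a * cnj a - b * cnj b) * w / d"
    using d by (simp add: field_simps) (simp add: d_def algebra_simps)
  moreover have "cnj a - b * ((cnj b + cnj a * w) / d) = (a * cnj a - b * cnj b) / d"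
    using d by (simp add: field_simps) (simp add: d_def algebra_simps)
  ultimately show ?thesis
    using d nz2 by (simp add: affine_moebius_def d_def[symmetric])
qed

lemma bij_betw_affine_moebius:
  assumes ab: "cmod b < cmod a"
  shows "bij_betw (affine_moebius a b) unit_disk unit_disk"
proof (rule bij_betw_byWitness[where f' = "affine_moebius (cnj a) (- b)"])
  have ab': "cmod (- b) < cmod (cnj a)" using ab by simp
  show "\<forall>w\<in>unit_disk. affine_moebius (cnj a) (- b) (affine_moebius a b w) = w"
    using affine_moebius_inverse[OF ab] by blast
  show "\<forall>w\<in>unit_disk. affine_moebius a b (affine_moebius (cnj a) (- b) w) = w"
    using affine_moebius_inverse[OF ab'] by simp
  show "affine_moebius a b ` unit_disk \<subseteq> unit_disk"
    using affine_moebius_in_disk[OF ab] by blast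
  show "affine_moebius (cnj a) (- b) ` unit_disk \<subseteq> unit_disk"
    using affine_moebius_in_disk[OF ab'] by blast
qed

text \<open>With k = |a|^2 - |b|^2 and p, q the denominators of the two image points, numerator and
  denominator of \<open>hyp_cosh2\<close> both acquire the factor k^2 / (|p|^2 |q|^2).\<close>

lemma hyp_cosh2_affine_moebius:
  assumes ab: "cmod b < cmod a" and c: "c \<in> unit_disk" and w: "w \<in> unit_disk"
  shows "hyp_cosh2 (affine_moebius a b c) (affine_moebius a b w) = hyp_cosh2 c w"
proof -
  define p q where "p = a + b * c" and "q = a + b * w"
  have nz: "p \<noteq> 0" "q \<noteq> 0"
    using affine_moebius_denominator[OF ab] c w by (auto simp: p_def q_def)
  define k where "k = (cmod a)\<^sup>2 - (cmod b)\<^sup>2"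
  have k: "k > 0" using norm_square_diff_pos[OF ab] by (simp add: k_def)
  have k': "complex_of_real k = a * cnj a - b * cnj b"
    by (simp add: k_def complex_norm_square[symmetric])
  have "1 - cnj (affine_moebius a b c) * affine_moebius a b w
      = (cnj p * q - cnj (cnj b + cnj a * c) * (cnj b + cnj a * w)) / (cnj p * q)"
    using nz by (simp add: affine_moebius_def p_def[symmetric] q_def[symmetric] diff_divide_distrib)
  also have "cnj p * q - cnj (cnj b + cnj a * c) * (cnj b + cnj a * w) = of_real k * (1 - cnj c * w)"
    unfolding k' by (simp add: p_def q_def algebra_simps)
  finally have "cmod (1 - cnj (affine_moebius a b c) * affine_moebius a b w)
      = k * cmod (1 - cnj c * w) / (cmod p * cmod q)"
    using k by (simp add: norm_mult norm_divide)
  then show ?thesis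
    unfolding hyp_cosh2_def affine_moebius_defect[OF ab c] affine_moebius_defect[OF ab w]
    unfolding k_def[symmetric] p_def[symmetric] q_def[symmetric]
    using k nz by (simp add: power_divide power_mult_distrib power2_eq_square[of k])
qed

lemma hyp_dist_affine_moebius:
  assumes "cmod b < cmod a" "c \<in> unit_disk" "w \<in> unit_disk"
  shows "hyp_dist (affine_moebius a b c) (affine_moebius a b w) = hyp_dist c w"
  using assms by (intro hyp_dist_eqI affine_moebius_in_disk hyp_cosh2_affine_moebius)

lemma continuous_on_affine_moebius:
  assumes "cmod b < cmod a" "S \<subseteq> unit_disk"
  shows "continuous_on S (affine_moebius a b)"
  unfolding affine_moebius_def
  using affine_moebius_denominator[OF assms(1)] assms(2)
  by (intro continuous_intros) fastforce

section \<open>Farthest points, Moebius invariance and Jung's theorem\<close>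

text \<open>Of at most three equal-norm vectors with barycenter zero, one of weight at least one third
  makes an angle of at least \<open>2\<pi>/3\<close> with another.\<close>

lemma wide_angle_in_farthest_set:
  assumes c0: "0 \<in> convex hull (T :: complex set)" and T: "\<And>z. z \<in> T \<Longrightarrow> cmod z = \<rho>" and \<rho>: "0 < \<rho>"
  obtains v w where "v \<in> T" "w \<in> T" "v \<bullet> w \<le> - (\<rho>\<^sup>2 / 2)"
proof -
  \<comment> \<open>Caratheodory's theorem in real dimension 2 leaves at most three points.\<close>
  obtain S where S: "finite S" "S \<subseteq> T" "card S \<le> 3" "0 \<in> convex hull S"
    using c0 unfolding caratheodory[of T] by auto
  then obtain u where u: "\<And>x. x \<in> S \<Longrightarrow> 0 \<le> u x" "sum u S = 1" "(\<Sum>x\<in>S. u x *\<^sub>R x) = 0"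
    unfolding convex_hull_finite[OF S(1)] by auto
  have "S \<noteq> {}" using u(2) by auto
  obtain j where j: "j \<in> S" "u j \<ge> 1 / 3"
  proof (rule ccontr)
    assume "\<not> thesis"
    then have lt: "\<And>x. x \<in> S \<Longrightarrow> u x < 1 / 3" using that by force
    have "sum u S < real (card S) * (1 / 3)"
      using sum_bounded_above_strict[of S u "1 / 3"] lt S(1) \<open>S \<noteq> {}\<close> by (simp add: card_gt_0_iff)
    also have "\<dots> \<le> 1" using S(3) by simp
    finally show False using u(2) by simp
  qed
  have jj: "j \<bullet> j = \<rho>\<^sup>2" using T[of j] j S(2) by (auto simp: dot_square_norm)
  show thesis
  proof (rule ccontr)
    assume "\<not> thesis"
    then have pos: "x \<bullet> j + \<rho>\<^sup>2 / 2 > 0" if "x \<in> S" for x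
      using that S(2) j(1) that by (smt (verit) \<open>\<And>v w. \<lbrakk>v \<in> T; w \<in> T; v \<bullet> w \<le> - (\<rho>\<^sup>2 / 2)\<rbrakk> \<Longrightarrow> thesis\<close> subsetD)
    have "(\<Sum>x\<in>S. u x * (x \<bullet> j)) = (\<Sum>x\<in>S. u x *\<^sub>R x) \<bullet> j"
      by (simp add: inner_sum_left)
    \<comment> \<open>Pairing the vanishing barycenter with j gives the total \<rho>^2 / 2. The term
      of j alone is at least 1/3 * 3/2 * \<rho>^2 = \<rho>^2 / 2 and the other terms are
      nonnegative, so these vanish and j would carry weight 1 as well as 1/3.\<close>
    then have "(\<Sum>x\<in>S. u x * (x \<bullet> j + \<rho>\<^sup>2 / 2)) = \<rho>\<^sup>2 / 2"
      using u(2,3) by (simp add: distrib_left sum.distrib flip: sum_distrib_right sum_divide_distrib)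
    moreover have "(\<Sum>x\<in>S. u x * (x \<bullet> j + \<rho>\<^sup>2 / 2))
        = u j * (3 / 2 * \<rho>\<^sup>2) + (\<Sum>x\<in>S-{j}. u x * (x \<bullet> j + \<rho>\<^sup>2 / 2))"
      using S(1) j(1) by (subst sum.remove[of S j]) (auto simp: jj)
    moreover have "u j * (3 / 2 * \<rho>\<^sup>2) \<ge> 1 / 3 * (3 / 2 * \<rho>\<^sup>2)"
      using j(2) by (intro mult_right_mono) auto
    moreover have "(\<Sum>x\<in>S-{j}. u x * (x \<bullet> j + \<rho>\<^sup>2 / 2)) \<ge> 0"
      using u(1) pos by (intro sum_nonneg mult_nonneg_nonneg) (auto intro: less_imp_le)
    ultimately have z: "(\<Sum>x\<in>S-{j}. u x * (x \<bullet> j + \<rho>\<^sup>2 / 2)) = 0" "u j * (3 / 2 * \<rho>\<^sup>2) = \<rho>\<^sup>2 / 2"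
      by linarith+
    have "\<forall>x\<in>S-{j}. u x * (x \<bullet> j + \<rho>\<^sup>2 / 2) = 0"
      using z(1) u(1) pos S(1)
      by (subst (asm) sum_nonneg_eq_0_iff) (auto intro!: mult_nonneg_nonneg intro: less_imp_le)
    then have "\<forall>x\<in>S-{j}. u x = 0" using pos by force
    then have "sum u S = u j" using S(1) j(1) by (subst sum.remove[of S j]) auto
    then show False using u(2) z(2) \<rho> by simp
  qed
qed

context compact_disk_set
begin

lemma compact_disk_set_moebius:
  assumes "cmod b < cmod a"
  shows "compact_disk_set (affine_moebius a b ` E)"
proof
  show "compact (affine_moebius a b ` E)"
    by (rule compact_continuous_image[OF continuous_on_affine_moebius[OF assms subset] compact])
  show "affine_moebius a b ` E \<noteq> {}" using nonempty by simp
  show "affine_moebius a b ` E \<subseteq> unit_disk" using affine_moebius_in_disk[OF assms] subset by blast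
qed

lemma hyp_radius_moebius:
  assumes "cmod b < cmod a" "c \<in> unit_disk"
  shows "hyp_radius (affine_moebius a b ` E) (affine_moebius a b c) = hyp_radius E c"
  unfolding hyp_radius_def image_image
  using assms subset by (intro SUP_cong refl hyp_dist_affine_moebius) auto

lemma circumcenter_moebius:
  assumes ab: "cmod b < cmod a"
  shows "circumcenter (affine_moebius a b ` E) = affine_moebius a b (circumcenter E)"
proof -
  interpret T: compact_disk_set "affine_moebius a b ` E" by (rule compact_disk_set_moebius[OF ab])
  have c: "is_circumcenter (circumcenter E)" by (simp add: circumcenter_iff)
  have "T.is_circumcenter (affine_moebius a b (circumcenter E))"
    unfolding T.is_circumcenter_def
  proof
    show "affine_moebius a b (circumcenter E) \<in> unit_disk"
      by (rule affine_moebius_in_disk[OF ab circumcenter_in_disk])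
    show "\<forall>c'\<in>unit_disk. hyp_radius (affine_moebius a b ` E) (affine_moebius a b (circumcenter E))
        \<le> hyp_radius (affine_moebius a b ` E) c'"
    proof
      fix c' :: complex assume "c' \<in> unit_disk"
      then obtain w where w: "w \<in> unit_disk" "c' = affine_moebius a b w"
        using bij_betw_imp_surj_on[OF bij_betw_affine_moebius[OF ab]] by blast
      then show "hyp_radius (affine_moebius a b ` E) (affine_moebius a b (circumcenter E))
          \<le> hyp_radius (affine_moebius a b ` E) c'"
        using c circumcenter_in_disk by (simp add: hyp_radius_moebius[OF ab] is_circumcenter_def)
    qed
  qed
  then show ?thesis by (simp add: T.circumcenter_iff)
qed

lemma hyp_diameter_moebius:
  assumes ab: "cmod b < cmod a"
  shows "hyp_diameter (affine_moebius a b ` E) = hyp_diameter E"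
proof -
  have "affine_moebius a b ` E \<times> affine_moebius a b ` E = map_prod (affine_moebius a b) (affine_moebius a b) ` (E \<times> E)"
    by (rule map_prod_surj_on[symmetric]) auto
  moreover have "hyp_dist (affine_moebius a b z) (affine_moebius a b w) = hyp_dist z w" if "z \<in> E" "w \<in> E" for z w
    using that subset by (intro hyp_dist_affine_moebius[OF ab]) auto
  ultimately show ?thesis
    unfolding hyp_diameter_def by (auto simp: image_image case_prod_beta intro!: SUP_cong)
qed

text \<open>If the origin were outside the convex hull of the farthest points, moving the center slightly
  along the normal of a separating line would decrease the radius.\<close>

lemma circumcenter_in_farthest_hull:
  assumes c0: "circumcenter E = 0" and e: "e \<in> E" and far: "\<And>z. z \<in> E \<Longrightarrow> cmod z \<le> cmod e"
  shows "0 \<in> convex hull {z\<in>E. cmod z = cmod e}"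
proof (rule ccontr)
  assume n0: "0 \<notin> convex hull {z\<in>E. cmod z = cmod e}"
  define \<rho> where "\<rho> = cmod e"
  have e1: "e \<in> unit_disk" using e subset by blast
  then have \<rho>: "0 \<le> \<rho>" "\<rho> < 1" by (auto simp: \<rho>_def)
  have cl: "closed {z::complex. cmod z = cmod e}" by (intro closed_Collect_eq continuous_intros)
  have "{z\<in>E. cmod z = cmod e} = E \<inter> {z. cmod z = cmod e}" by auto
  then have "compact {z\<in>E. cmod z = cmod e}"
    using compact_Int_closed[OF compact cl] by simp
  then have "closed (convex hull {z\<in>E. cmod z = cmod e})"
    using compact_convex_hull compact_imp_closed by blast
  then obtain a b where ab: "a \<noteq> 0" "0 < b" "\<And>x. x \<in> convex hull {z\<in>E. cmod z = cmod e} \<Longrightarrow> a \<bullet> x > b"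
    using separating_hyperplane_closed_0[OF convex_convex_hull _ n0] by metis
  have T: "a \<bullet> x > b" if "x \<in> E" "cmod x = \<rho>" for x
    using that by (intro ab(3) hull_inc) (simp add: \<rho>_def)
  \<comment> \<open>The points of E not beyond the separating line. No farthest point lies among
    them, so compactness keeps their norms below some \<sigma> < \<rho>; for empty \<open>K\<close>
    the value 0 is a placeholder.\<close>
  define K where "K = E \<inter> {z. a \<bullet> z \<le> b}"
  have "compact K" unfolding K_def by (intro compact_Int_closed compact closed_halfspace_le)
  obtain \<sigma> where \<sigma>: "0 \<le> \<sigma>" "\<sigma>\<^sup>2 < \<rho>\<^sup>2 \<or> K = {}" "\<sigma> < 1" "\<And>z. z \<in> K \<Longrightarrow> cmod z \<le> \<sigma>"
  proof (cases "K = {}")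
    case True
    then show thesis by (intro that[of 0]) auto
  next
    case False
    obtain k where k: "k \<in> K" "\<And>z. z \<in> K \<Longrightarrow> cmod z \<le> cmod k"
      using continuous_attains_sup[OF \<open>compact K\<close> False continuous_on_norm_id] by auto
    have "cmod k \<le> \<rho>" "cmod k \<noteq> \<rho>" using k(1) far T[of k] by (auto simp: K_def \<rho>_def)
    then have "cmod k < \<rho>" by simp
    then have "(cmod k)\<^sup>2 < \<rho>\<^sup>2" by (intro power_strict_mono) auto
    then show thesis using k \<open>cmod k < \<rho>\<close> \<rho> by (intro that[of "cmod k"]) auto
  qed
  define A where "A = (cmod a)\<^sup>2"
  have A: "A > 0" using ab(1) by (simp add: A_def)
  define s where "s = 1 / (1 - \<rho>\<^sup>2)"
  have r1: "1 - \<rho>\<^sup>2 > 0" and s1: "1 - \<sigma>\<^sup>2 > 0" using \<rho> \<sigma> by (auto simp: abs_square_less_1)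
  \<comment> \<open>With the center moved to t a, \<open>M1\<close> bounds \<open>hyp_cosh2\<close>
    on the points beyond the line and \<open>M2\<close> on \<open>K\<close>. For small t they lie
    below s, the value at the farthest points seen from 0: in \<open>M1\<close> the linear gain 2 t
    b outweighs the terms in t^2, and for nonempty \<open>K\<close> the limit 1 / (1 - \<sigma>^2)
    of \<open>M2\<close> is less than s.\<close>
  define M1 where "M1 = (\<lambda>t. (1 - 2 * t * b + t\<^sup>2 * A) / ((1 - t\<^sup>2 * A) * (1 - \<rho>\<^sup>2)))"
  define M2 where "M2 = (\<lambda>t. (1 + t * cmod a)\<^sup>2 / ((1 - t\<^sup>2 * A) * (1 - \<sigma>\<^sup>2)))"
  have ev: "eventually (\<lambda>t. 0 < t \<and> t * A < b \<and> t\<^sup>2 * A < 1 \<and> (K \<noteq> {} \<longrightarrow> M2 t < s)) (at_right 0)"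
  proof (intro eventually_conj)
    show "eventually (\<lambda>t::real. 0 < t) (at_right 0)" by (rule eventually_at_right_less)
    have "((\<lambda>t. t * A) \<longlongrightarrow> 0 * A) (at_right 0)" by (intro tendsto_intros)
    then show "eventually (\<lambda>t. t * A < b) (at_right 0)" using ab(2) by (intro order_tendstoD) auto
    have "((\<lambda>t. t\<^sup>2 * A) \<longlongrightarrow> 0\<^sup>2 * A) (at_right 0)" by (intro tendsto_intros)
    then show "eventually (\<lambda>t. t\<^sup>2 * A < 1) (at_right 0)" by (intro order_tendstoD) auto
    have "(M2 \<longlongrightarrow> (1 + 0 * cmod a)\<^sup>2 / ((1 - 0\<^sup>2 * A) * (1 - \<sigma>\<^sup>2))) (at_right 0)"
      unfolding M2_def using s1 by (intro tendsto_intros) auto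
    moreover have "1 / (1 - \<sigma>\<^sup>2) < s" if "K \<noteq> {}"
      unfolding s_def using \<sigma>(2) that r1 s1 by (intro divide_strict_left_mono mult_pos_pos) auto
    ultimately show "eventually (\<lambda>t. K \<noteq> {} \<longrightarrow> M2 t < s) (at_right 0)"
      by (cases "K = {}") (auto intro: order_tendstoD)
  qed
  obtain t where t: "0 < t" "t * A < b" "t\<^sup>2 * A < 1" "K \<noteq> {} \<Longrightarrow> M2 t < s"
    using eventually_happens'[OF trivial_limit_at_right_real ev] by auto
  define c where "c = of_real t * a"
  have c2: "(cmod c)\<^sup>2 = t\<^sup>2 * A" using t by (simp add: c_def norm_mult power_mult_distrib A_def)
  then have c: "c \<in> unit_disk" using t(3) abs_square_less_1[of "cmod c"] by simp
  have M1: "M1 t < s"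
  proof -
    have "t * (t * A) < t * b" using t by simp
    then have "1 - 2 * t * b + t\<^sup>2 * A < 1 - t\<^sup>2 * A" by (simp add: power2_eq_square mult_ac)
    then have "(1 - 2 * t * b + t\<^sup>2 * A) / (1 - t\<^sup>2 * A) < 1" using t(3) by simp
    then have "(1 - 2 * t * b + t\<^sup>2 * A) / (1 - t\<^sup>2 * A) / (1 - \<rho>\<^sup>2) < 1 / (1 - \<rho>\<^sup>2)"
      using r1 by (intro divide_strict_right_mono) auto
    then show ?thesis by (simp add: M1_def s_def)
  qed
  define M where "M = (if K = {} then M1 t else max (M1 t) (M2 t))"
  have "hyp_radius E c < hyp_radius E 0"
  proof (rule hyp_radius_less[OF c hyp_radius_nonneg])
    have "s = hyp_cosh2 0 e" by (simp add: hyp_cosh2_def s_def \<rho>_def)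
    also have "\<dots> \<le> (cosh (hyp_radius E 0 / 2))\<^sup>2" by (rule hyp_cosh2_le_radius[OF _ e]) simp
    moreover have "M < s" unfolding M_def using M1 t(4) by (cases "K = {}") simp_all
    ultimately show "M < (cosh (hyp_radius E 0 / 2))\<^sup>2" by linarith
  next
    fix \<zeta> assume \<zeta>: "\<zeta> \<in> E"
    have le: "cmod \<zeta> \<le> \<rho>" using far[OF \<zeta>] by (simp add: \<rho>_def)
    show "hyp_cosh2 c \<zeta> \<le> M"
    proof (cases "\<zeta> \<in> K")
      case True
      have "hyp_cosh2 c \<zeta> \<le> M2 t"
        unfolding hyp_cosh2_def M2_def c2
      proof (rule frac_le)
        have "cmod (1 - cnj c * \<zeta>) \<le> 1 + cmod c * cmod \<zeta>"
          using norm_triangle_ineq4[of 1 "cnj c * \<zeta>"] by (simp add: norm_mult)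
        also have "\<dots> \<le> 1 + cmod c * 1" using le \<rho> by (intro add_left_mono mult_left_mono) auto
        also have "cmod c = t * cmod a" using t by (simp add: c_def norm_mult)
        finally show "(cmod (1 - cnj c * \<zeta>))\<^sup>2 \<le> (1 + t * cmod a)\<^sup>2" by (intro power_mono) auto
        show "0 < (1 - t\<^sup>2 * A) * (1 - \<sigma>\<^sup>2)" using t s1 by simp
        have "(cmod \<zeta>)\<^sup>2 \<le> \<sigma>\<^sup>2" using \<sigma>(4)[OF True] by (intro power_mono) auto
        then show "(1 - t\<^sup>2 * A) * (1 - \<sigma>\<^sup>2) \<le> (1 - t\<^sup>2 * A) * (1 - (cmod \<zeta>)\<^sup>2)"
          using t by (intro mult_left_mono) auto
      qed simp
      then show ?thesis using True by (auto simp: M_def)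
    next
      case False
      then have ip: "a \<bullet> \<zeta> > b" using \<zeta> by (auto simp: K_def)
      have z2: "(cmod \<zeta>)\<^sup>2 \<le> \<rho>\<^sup>2" using le by (intro power_mono) auto
      have "hyp_cosh2 c \<zeta> \<le> M1 t"
        unfolding hyp_cosh2_def M1_def c2
      proof (rule frac_le)
        have "(cmod (1 - cnj c * \<zeta>))\<^sup>2 = 1 - 2 * t * (a \<bullet> \<zeta>) + t\<^sup>2 * A * (cmod \<zeta>)\<^sup>2"
          unfolding cmod_power2 A_def c_def inner_complex_def
          by (simp add: power2_eq_square algebra_simps)
        also have "\<dots> \<le> 1 - 2 * t * b + t\<^sup>2 * A * 1"
        proof -
          have "t * b \<le> t * (a \<bullet> \<zeta>)" using t ip by simp
          moreover have "(cmod \<zeta>)\<^sup>2 \<le> 1" using z2 r1 by linarith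
          then have "t\<^sup>2 * A * (cmod \<zeta>)\<^sup>2 \<le> t\<^sup>2 * A * 1" using A by (intro mult_left_mono) auto
          ultimately show ?thesis by linarith
        qed
        finally show "(cmod (1 - cnj c * \<zeta>))\<^sup>2 \<le> 1 - 2 * t * b + t\<^sup>2 * A" by simp
        then show "0 \<le> 1 - 2 * t * b + t\<^sup>2 * A" by (rule order_trans[rotated]) simp
        show "0 < (1 - t\<^sup>2 * A) * (1 - \<rho>\<^sup>2)" using t r1 by simp
        show "(1 - t\<^sup>2 * A) * (1 - \<rho>\<^sup>2) \<le> (1 - t\<^sup>2 * A) * (1 - (cmod \<zeta>)\<^sup>2)"
          using t z2 by (intro mult_left_mono) auto
      qed
      then show ?thesis by (auto simp: M_def)
    qed
  qed simp
  moreover have "is_circumcenter 0" using c0 by (simp add: circumcenter_iff)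
  ultimately show False using c unfolding is_circumcenter_def by (meson not_less)
qed

text \<open>Two farthest points v, w at an angle of at least 2 pi / 3 satisfy |v - w|^2 >= 3
  \<rho>^2, so the diameter bound gives sqrt 3 \<rho> / (1 - \<rho>^2) <= sinh (D / 2). Since 2
  \<rho> / (1 - \<rho>^2) is sinh of the hyperbolic distance from 0 to \<rho>, the factor 2 / sqrt 3
  of \<open>jung_radius\<close> appears.\<close>

lemma jung_inequality:
  assumes c0: "circumcenter E = 0" and D: "hyp_diameter E \<le> D" and z: "z \<in> E"
  shows "cmod z \<le> tanh (jung_radius D / 2)"
proof -
  obtain \<rho> e where e: "e \<in> E" "cmod e = \<rho>" "0 \<le> \<rho>" "\<rho> < 1" "\<And>z. z \<in> E \<Longrightarrow> cmod z \<le> \<rho>"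
    using compact_disk_bound[OF compact nonempty subset] by metis
  have D0: "0 \<le> D" using D hyp_diameter_nonneg by simp
  have "\<rho> \<le> tanh (jung_radius D / 2)"
  proof (cases "\<rho> = 0")
    case True
    have "0 \<le> 2 / sqrt 3 * sinh (D / 2)" using D0 by simp
    then have "0 \<le> jung_radius D" unfolding jung_radius_def by (metis arsinh_real_neg_iff not_less)
    then show ?thesis using True by simp
  next
    case False
    then have \<rho>: "0 < \<rho>" using e by simp
    have "0 \<in> convex hull {z\<in>E. cmod z = \<rho>}"
      using circumcenter_in_farthest_hull[OF c0 e(1)] e by simp
    then obtain v w where vw: "v \<in> {z\<in>E. cmod z = \<rho>}" "w \<in> {z\<in>E. cmod z = \<rho>}" "v \<bullet> w \<le> - (\<rho>\<^sup>2 / 2)"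
      using wide_angle_in_farthest_set[of "{z\<in>E. cmod z = \<rho>}" \<rho>] \<rho> by blast
    have d: "v \<in> unit_disk" "w \<in> unit_disk" using vw subset by auto
    define q where "q = 1 - \<rho>\<^sup>2"
    have q: "q > 0" using e by (auto simp: q_def abs_square_less_1)
    have "(cmod (v - w))\<^sup>2 = (cmod v)\<^sup>2 + (cmod w)\<^sup>2 - 2 * (v \<bullet> w)"
      unfolding dot_square_norm[symmetric] by (simp add: inner_diff inner_commute algebra_simps)
    then have "(cmod (v - w))\<^sup>2 \<ge> 3 * \<rho>\<^sup>2" using vw by simp
    moreover have "hyp_cosh2 v w = 1 + (cmod (v - w))\<^sup>2 / q\<^sup>2"
      using vw(1,2) unfolding hyp_cosh2_eq[OF d] by (simp add: q_def power2_eq_square[of "1 - _"])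
    ultimately have "1 + 3 * \<rho>\<^sup>2 / q\<^sup>2 \<le> hyp_cosh2 v w"
      by (simp add: divide_right_mono)
    also have "\<dots> \<le> (cosh (D / 2))\<^sup>2"
      using hyp_dist_le_iff[OF d D0] order_trans[OF hyp_dist_le_diameter D] vw(1,2) by blast
    finally have "3 * \<rho>\<^sup>2 / q\<^sup>2 \<le> (sinh (D / 2))\<^sup>2"
      unfolding cosh_square_eq by linarith
    then have "(sqrt 3 * \<rho> / q)\<^sup>2 \<le> (sinh (D / 2))\<^sup>2" by (simp add: power_divide power_mult_distrib)
    then have "sqrt 3 * \<rho> / q \<le> sinh (D / 2)" by (rule power2_le_imp_le) (use D0 in simp)
    then have "2 / sqrt 3 * (sqrt 3 * \<rho> / q) \<le> 2 / sqrt 3 * sinh (D / 2)"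
      by (intro mult_left_mono) auto
    then have le: "2 * \<rho> / q \<le> 2 / sqrt 3 * sinh (D / 2)" by simp
    define y where "y = artanh \<rho>"
    have ty: "tanh y = \<rho>" using e unfolding y_def by (intro tanh_artanh_real) auto
    have sc: "sinh y = \<rho> * cosh y" using ty[symmetric] by (simp add: tanh_def)
    then have "(cosh y)\<^sup>2 * q = 1"
      using cosh_square_eq[of y] by (simp add: q_def algebra_simps power_mult_distrib)
    then have "(cosh y)\<^sup>2 = 1 / q" using q by (simp add: eq_divide_eq)
    moreover have "sinh (2 * y) = 2 * \<rho> * (cosh y)\<^sup>2"
      unfolding sinh_double sc by (simp add: power2_eq_square)
    ultimately have "sinh (2 * y) = 2 * \<rho> / q" by simp
    then have "sinh (2 * y) \<le> sinh (jung_radius D)" using le by (simp add: jung_radius_def)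
    then have "y \<le> jung_radius D / 2" by simp
    then show ?thesis using ty by (metis tanh_real_le_iff)
  qed
  then show ?thesis using e(5)[OF z] by linarith
qed

end

section \<open>Target-affine changes and balanced representatives\<close>

text \<open>The Wirtinger derivative of f recovers h', and that of cnj f recovers g', once the
  constant h(0) is moved over to keep the normalization at 0. Thus any explicit decomposition
  computes the Jacobian and dilatation, although these are defined through chosen parts.\<close>

lemma harmonic_decomp_unique:
  assumes 1: "harmonic_decomp f h g" and 2: "harmonic_decomp f h' g'" and z: "z \<in> unit_disk"
  shows "deriv h z = deriv h' z" "deriv g z = deriv g' z"
proof -
  show "deriv h z = deriv h' z"
    using wirtinger_harmonic[OF 1 z] wirtinger_harmonic[OF 2 z] by simp
  have dg: "wirtinger (\<lambda>w. cnj (f w)) z = deriv g z" if "harmonic_decomp f h g" for h g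
  proof -
    have hol: "h holomorphic_on unit_disk" "g holomorphic_on unit_disk"
      using that by (auto simp: harmonic_decomp_def)
    have "harmonic_decomp (\<lambda>w. cnj (f w)) (\<lambda>w. g w + cnj (h 0)) (\<lambda>w. h w - h 0)"
      using that by (auto simp: harmonic_decomp_def intro!: holomorphic_intros)
    then have "wirtinger (\<lambda>w. cnj (f w)) z = deriv (\<lambda>w. g w + cnj (h 0)) z"
      by (rule wirtinger_harmonic[OF _ z])
    also have "\<dots> = deriv g z"
      using holomorphic_on_imp_differentiable_at[OF hol(2) open_ball z] by simp
    finally show ?thesis .
  qed
  show "deriv g z = deriv g' z" using dg[OF 1] dg[OF 2] by simp
qed

lemma harmonic_jacobian_eq:
  assumes "harmonic_decomp f h g" "z \<in> unit_disk"
  shows "harmonic_jacobian f z = (cmod (deriv h z))\<^sup>2 - (cmod (deriv g z))\<^sup>2"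
  using harmonic_decomp_unique[OF harmonic_decomp_parts[OF assms(1)] assms]
  by (simp add: harmonic_jacobian_def)

lemma op_harmonic_iff:
  assumes "harmonic_decomp f h g"
  shows "op_harmonic f \<longleftrightarrow> (\<forall>z\<in>unit_disk. cmod (deriv g z) < cmod (deriv h z))"
proof -
  have "0 < (cmod (deriv h z))\<^sup>2 - (cmod (deriv g z))\<^sup>2 \<longleftrightarrow> cmod (deriv g z) < cmod (deriv h z)" for z
    by (auto intro: power_strict_mono dest: power_less_imp_less_base)
  then show ?thesis
    unfolding op_harmonic_def using assms harmonic_jacobian_eq[OF assms] by auto
qed

lemma dilatation_eq:
  assumes "harmonic_decomp f h g" "z \<in> unit_disk"
  shows "dilatation f z = deriv g z / deriv h z"
  using harmonic_decomp_unique[OF harmonic_decomp_parts[OF assms(1)] assms]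
  by (simp add: dilatation_def)

lemma op_harmonicD:
  assumes f: "op_harmonic f"
  shows op_harmonic_decomp: "harmonic_decomp f (analytic_part f) (coanalytic_part f)"
    and deriv_analytic_part_nonzero: "z \<in> unit_disk \<Longrightarrow> deriv (analytic_part f) z \<noteq> 0"
    and dilatation_in_disk: "z \<in> unit_disk \<Longrightarrow> dilatation f z \<in> unit_disk"
    and dilatation_holomorphic: "dilatation f holomorphic_on unit_disk"
proof -
  show d: "harmonic_decomp f (analytic_part f) (coanalytic_part f)"
    using f harmonic_decomp_parts unfolding op_harmonic_def by blast
  have less: "cmod (deriv (coanalytic_part f) z) < cmod (deriv (analytic_part f) z)" if "z \<in> unit_disk" for z
    using f that unfolding op_harmonic_iff[OF d] by blast
  then show nz: "deriv (analytic_part f) z \<noteq> 0" if "z \<in> unit_disk" for z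
    using that by fastforce
  show "dilatation f z \<in> unit_disk" if "z \<in> unit_disk" for z
    using less[OF that] nz[OF that] by (simp add: dilatation_def norm_divide)
  show "dilatation f holomorphic_on unit_disk"
    unfolding dilatation_def using d nz
    by (intro holomorphic_on_divide holomorphic_deriv) (auto simp: harmonic_decomp_def)
qed

lemma dilatation_le_disk_norm:
  assumes "op_harmonic f" "z \<in> unit_disk"
  shows "cmod (dilatation f z) \<le> disk_norm (dilatation f)"
  unfolding disk_norm_def
  using dilatation_in_disk[OF assms(1)] assms(2)
  by (intro cSUP_upper bdd_aboveI[of _ 1]) (auto intro: less_imp_le)

lemma disk_norm_nonneg: "op_harmonic f \<Longrightarrow> 0 \<le> disk_norm (dilatation f)"
  by (rule order_trans[OF norm_ge_zero dilatation_le_disk_norm[of f 0]]) auto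

lemma disk_norm_le: "(\<And>z. z \<in> unit_disk \<Longrightarrow> cmod (w z) \<le> k) \<Longrightarrow> disk_norm w \<le> k"
  unfolding disk_norm_def by (rule cSUP_least) auto

lemma compact_dilatation_range:
  assumes "admissible f"
  shows "compact_disk_set (closure (dilatation f ` unit_disk))"
proof -
  have op: "op_harmonic f" and k: "disk_norm (dilatation f) < 1"
    using assms by (auto simp: admissible_def)
  have sub: "dilatation f ` unit_disk \<subseteq> cball 0 (disk_norm (dilatation f))"
    using dilatation_le_disk_norm[OF op] by auto
  have "closure (dilatation f ` unit_disk) \<subseteq> cball 0 (disk_norm (dilatation f))"
    by (rule closure_minimal[OF sub closed_cball])
  then show ?thesis
    using k by unfold_locales (auto intro: bounded_subset[OF bounded_cball sub] simp: compact_closure)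
qed

text \<open>\<open>c_aff\<close> and \<open>d_aff\<close> look at the closure of the range.
  Continuity gives one inclusion; the other holds because the image of the compact closure is
  closed.\<close>

lemma closure_affine_moebius_image:
  assumes "compact_disk_set (closure S)" "cmod b < cmod a"
  shows "closure (affine_moebius a b ` S) = affine_moebius a b ` closure S"
proof
  interpret compact_disk_set "closure S" by fact
  interpret T: compact_disk_set "affine_moebius a b ` closure S"
    by (rule compact_disk_set_moebius[OF assms(2)])
  show "closure (affine_moebius a b ` S) \<subseteq> affine_moebius a b ` closure S"
    using closure_subset compact_imp_closed[OF T.compact] by (intro closure_minimal image_mono)
  show "affine_moebius a b ` closure S \<subseteq> closure (affine_moebius a b ` S)"
    using closure_subset[of "affine_moebius a b ` S"]
    by (intro image_closure_subset continuous_on_affine_moebius[OF assms(2) subset]) auto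
qed

text \<open>The hypothesis on u concerns the disk only, so the facts apply to a composition with an
  affine map, to a balanced representative restricted to the disk, and to another member of the same
  class.\<close>

lemma target_affine_change:
  assumes f: "admissible f" and ab: "cmod b < cmod a"
    and u: "\<And>z. z \<in> unit_disk \<Longrightarrow> u z = a * f z + b * cnj (f z) + c"
  shows deriv_analytic_part_affine: "\<And>z. z \<in> unit_disk \<Longrightarrow> deriv (analytic_part u) z =
      a * deriv (analytic_part f) z + b * deriv (coanalytic_part f) z"
    and dilatation_affine: "\<And>z. z \<in> unit_disk \<Longrightarrow> dilatation u z = affine_moebius a b (dilatation f z)"
    and admissible_affine: "admissible u"
    and c_aff_affine: "c_aff u = affine_moebius a b (c_aff f)"
    and d_aff_affine: "d_aff u = d_aff f"
proof -
  have op: "op_harmonic f" and inj: "inj_on f unit_disk" and k: "disk_norm (dilatation f) < 1"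
    using f by (auto simp: admissible_def univalent_def)
  define h g where "h = analytic_part f" and "g = coanalytic_part f"
  have d: "harmonic_decomp f h g" using op_harmonic_decomp[OF op] by (simp add: h_def g_def)
  have hol: "h holomorphic_on unit_disk" "g holomorphic_on unit_disk"
    and fz: "\<And>z. z \<in> unit_disk \<Longrightarrow> f z = h z + cnj (g z)" and g0: "g 0 = 0"
    using d by (auto simp: harmonic_decomp_def)
  \<comment> \<open>The constants are shifted so that g' vanishes at 0, as
    \<open>harmonic_decomp\<close> demands; h' absorbs the difference.\<close>
  define h' g' where "h' = (\<lambda>z. a * h z + b * g z + (c + b * cnj (h 0)))"
    and "g' = (\<lambda>z. cnj b * h z + cnj a * g z - cnj b * h 0)"
  have d': "harmonic_decomp u h' g'"
    unfolding harmonic_decomp_def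
  proof (intro conjI ballI)
    show "h' holomorphic_on unit_disk" "g' holomorphic_on unit_disk"
      unfolding h'_def g'_def by (intro holomorphic_intros hol)+
    show "g' 0 = 0" by (simp add: g'_def g0)
    show "u z = h' z + cnj (g' z)" if "z \<in> unit_disk" for z
      using u[OF that] fz[OF that] by (simp add: h'_def g'_def algebra_simps)
  qed
  have der: "deriv h' z = a * deriv h z + b * deriv g z" "deriv g' z = cnj b * deriv h z + cnj a * deriv g z"
    if z: "z \<in> unit_disk" for z
    unfolding h'_def g'_def
    using holomorphic_derivI[OF hol(1) open_ball z] holomorphic_derivI[OF hol(2) open_ball z]
    by (auto intro!: DERIV_imp_deriv derivative_eq_intros)
  show "deriv (analytic_part u) z = a * deriv (analytic_part f) z + b * deriv (coanalytic_part f) z"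
    if z: "z \<in> unit_disk" for z
    using harmonic_decomp_unique(1)[OF harmonic_decomp_parts[OF d'] d' z] der[OF z] by (simp add: h_def g_def)
  have nz: "deriv h z \<noteq> 0" if "z \<in> unit_disk" for z
    using deriv_analytic_part_nonzero[OF op that] by (simp add: h_def)
  have \<omega>g: "deriv g z = dilatation f z * deriv h z" if "z \<in> unit_disk" for z
    using dilatation_eq[OF d that] nz[OF that] by simp
  have den: "a + b * dilatation f z \<noteq> 0" if "z \<in> unit_disk" for z
    using affine_moebius_denominator[OF ab, of "dilatation f z"] dilatation_in_disk[OF op that] by simp
  have h'z: "deriv h' z = (a + b * dilatation f z) * deriv h z"
    and g'z: "deriv g' z = (cnj b + cnj a * dilatation f z) * deriv h z" if "z \<in> unit_disk" for z
    using der[OF that] \<omega>g[OF that] by (auto simp: algebra_simps)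
  show dil: "dilatation u z = affine_moebius a b (dilatation f z)" if z: "z \<in> unit_disk" for z
    using dilatation_eq[OF d' z] h'z[OF z] g'z[OF z] nz[OF z] by (simp add: affine_moebius_def)
  have opu: "op_harmonic u"
    unfolding op_harmonic_iff[OF d']
  proof
    fix z :: complex assume z: "z \<in> unit_disk"
    have "deriv h' z \<noteq> 0" using h'z[OF z] den[OF z] nz[OF z] by simp
    moreover have "cmod (deriv g' z / deriv h' z) < 1"
      using affine_moebius_in_disk[OF ab dilatation_in_disk[OF op z]] dil[OF z] dilatation_eq[OF d' z] by simp
    ultimately show "cmod (deriv g' z) < cmod (deriv h' z)" by (simp add: norm_divide)
  qed
  interpret compact_disk_set "closure (dilatation f ` unit_disk)" by (rule compact_dilatation_range[OF f])
  interpret T: compact_disk_set "affine_moebius a b ` closure (dilatation f ` unit_disk)"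
    by (rule compact_disk_set_moebius[OF ab])
  have "dilatation u ` unit_disk = affine_moebius a b ` dilatation f ` unit_disk"
    using dil by (auto simp: image_image)
  then have cl: "closure (dilatation u ` unit_disk) = affine_moebius a b ` closure (dilatation f ` unit_disk)"
    by (simp add: closure_affine_moebius_image[OF compact_dilatation_range[OF f] ab])
  show "c_aff u = affine_moebius a b (c_aff f)"
    unfolding c_aff_def cl by (rule circumcenter_moebius[OF ab])
  show "d_aff u = d_aff f"
    unfolding d_aff_def cl by (rule hyp_diameter_moebius[OF ab])
  obtain \<rho> e where \<rho>: "\<rho> < 1" "\<And>z. z \<in> affine_moebius a b ` closure (dilatation f ` unit_disk) \<Longrightarrow> cmod z \<le> \<rho>"
    using compact_disk_bound[OF T.compact T.nonempty T.subset] by metis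
  have "disk_norm (dilatation u) \<le> \<rho>"
    using \<rho>(2) closure_subset[of "dilatation u ` unit_disk"] unfolding cl[symmetric] by (intro disk_norm_le) blast
  moreover have "inj_on u unit_disk"
  proof (rule inj_onI)
    fix x y assume x: "x \<in> unit_disk" and y: "y \<in> unit_disk" and "u x = u y"
    then have "a * (f x - f y) = - (b * cnj (f x - f y))"
      by (simp add: u algebra_simps add_eq_0_iff)
    then have "cmod a * cmod (f x - f y) = cmod b * cmod (f x - f y)"
      by (metis complex_mod_cnj norm_minus_cancel norm_mult)
    then have "f x = f y" using ab by auto
    then show "x = y" using inj_onD[OF inj] x y by blast
  qed
  ultimately show "admissible u" using opu \<rho>(1) by (simp add: admissible_def univalent_def)
qed

lemma exists_balancing_affine:
  assumes f: "admissible f"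
  shows "\<exists>A. op_affine A \<and> c_aff (A \<circ> f) = 0"
proof -
  interpret compact_disk_set "closure (dilatation f ` unit_disk)" by (rule compact_dilatation_range[OF f])
  \<comment> \<open>With a = 1 the numerator of the Moebius map is cnj b + w, which this b makes
    vanish at w = \<open>c_aff f\<close>.\<close>
  define b where "b = - cnj (c_aff f)"
  have b: "cmod b < cmod 1" using circumcenter_in_disk by (simp add: b_def c_aff_def)
  define A where "A = (\<lambda>w. 1 * w + b * cnj w + 0)"
  have "c_aff (A \<circ> f) = affine_moebius 1 b (c_aff f)"
    by (rule c_aff_affine[OF f b, of _ 0]) (simp add: A_def)
  also have "\<dots> = 0" by (simp add: affine_moebius_def b_def)
  finally show ?thesis using b unfolding op_affine_def A_def by blast
qed

text \<open>The balancing affine map is followed by division by the nonzero derivative l and a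
  translation. This second change has b = 0 and acts on the dilatation as a rotation about 0, so the
  circumcenter stays at 0.\<close>

lemma balanced_rep_properties:
  assumes f: "admissible f"
  defines "F \<equiv> balanced_rep f"
  shows "admissible F" "deriv (analytic_part F) 0 = 1" "c_aff F = 0" "d_aff F = d_aff f"
proof -
  define A where "A = (SOME A. op_affine A \<and> c_aff (A \<circ> f) = 0)"
  have A: "op_affine A" "c_aff (A \<circ> f) = 0"
    using someI_ex[OF exists_balancing_affine[OF f]] by (auto simp: A_def)
  then obtain a b c where ab: "cmod b < cmod a" and A': "A = (\<lambda>w. a * w + b * cnj w + c)"
    unfolding op_affine_def by blast
  define U where "U = A \<circ> f"
  have u: "U z = a * f z + b * cnj (f z) + c" for z by (simp add: U_def A')
  have U: "admissible U" by (rule admissible_affine[OF f ab u])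
  then have opU: "op_harmonic U" by (simp add: admissible_def)
  define l where "l = deriv (analytic_part U) 0"
  have l: "l \<noteq> 0" using deriv_analytic_part_nonzero[OF opU] by (simp add: l_def)
  have wl: "wirtinger U 0 = l"
    unfolding l_def by (rule wirtinger_harmonic[OF op_harmonic_decomp[OF opU]]) simp
  have F: "F z = 1 / l * U z + 0 * cnj (U z) + - A (f 0) / l" if "z \<in> unit_disk" for z
    using that unfolding F_def balanced_rep_def A_def[symmetric] U_def[symmetric] wl Let_def
    by (simp add: U_def diff_divide_distrib)
  have l': "cmod 0 < cmod (1 / l)" using l by simp
  show "admissible F" by (rule admissible_affine[OF U l' F])
  show "deriv (analytic_part F) 0 = 1"
    using deriv_analytic_part_affine[OF U l' F, of 0] l by (simp add: l_def)
  show "c_aff F = 0"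
    using c_aff_affine[OF U l' F] A(2) by (simp add: affine_moebius_def U_def[symmetric])
  show "d_aff F = d_aff f"
    using d_aff_affine[OF U l' F] d_aff_affine[OF f ab u] by simp
qed

text \<open>\<open>balanced_section\<close> ranges over all f whose class lies in the family, while
  the family is given by classes of admissible maps. As f belongs to its own class, it is an affine
  change of the admissible f0.\<close>

lemma admissible_of_aff_class:
  assumes "aff_class f = aff_class f0" "admissible f0"
  shows "admissible f"
proof -
  have "f \<in> aff_class f"
    unfolding aff_class_def op_affine_def
  proof (intro CollectI exI conjI)
    show "cmod 0 < cmod (1 :: complex)" by simp
    show "(\<lambda>w. w) = (\<lambda>w. 1 * w + 0 * cnj w + 0)" by simp
  qed simp
  then obtain A where "op_affine A" and fA: "\<And>z. z \<in> unit_disk \<Longrightarrow> f z = A (f0 z)"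
    using assms(1) unfolding aff_class_def by auto
  then obtain a b c where ab: "cmod b < cmod a" and A: "A = (\<lambda>w. a * w + b * cnj w + c)"
    unfolding op_affine_def by blast
  show ?thesis
    by (rule admissible_affine[OF assms(2) ab, of f c]) (use fA A in simp)
qed

lemma balanced_section_properties:
  assumes \<F>: "invariant_class \<F>" and F: "F \<in> balanced_section \<F>"
  shows "admissible F" "deriv (analytic_part F) 0 = 1"
proof -
  obtain f where f: "F = balanced_rep f" "aff_class f \<in> \<F>"
    using F unfolding balanced_section_def by blast
  then obtain f0 where "aff_class f = aff_class f0" "admissible f0"
    using \<F> unfolding invariant_class_def by blast
  then have "admissible f" by (rule admissible_of_aff_class)
  then show "admissible F" "deriv (analytic_part F) 0 = 1"
    using balanced_rep_properties f(1) by auto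
qed

lemma balanced_section_nonempty: "invariant_class \<F> \<Longrightarrow> balanced_section \<F> \<noteq> {}"
  unfolding invariant_class_def balanced_section_def by blast

text \<open>Balancing puts the circumcenter at 0 and keeps the diameter, so Jung's inequality
  applies to the closed range of the dilatation.\<close>

lemma S_balanced_dilatation_bound:
  assumes "F \<in> S_balanced D"
  shows "disk_norm (dilatation F) \<le> tanh (jung_radius D / 2)"
proof -
  obtain f where f: "F = balanced_rep f" "admissible f" "d_aff f \<le> D"
    using assms unfolding S_balanced_def by blast
  have F: "admissible F" "c_aff F = 0" "d_aff F \<le> D"
    using balanced_rep_properties[OF f(2)] f by auto
  interpret compact_disk_set "closure (dilatation F ` unit_disk)" by (rule compact_dilatation_range[OF F(1)])
  show ?thesis
  proof (rule disk_norm_le)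
    fix z assume "z \<in> unit_disk"
    then have "dilatation F z \<in> closure (dilatation F ` unit_disk)"
      by (intro subsetD[OF closure_subset] imageI)
    then show "cmod (dilatation F z) \<le> tanh (jung_radius D / 2)"
      using jung_inequality F(2,3) by (simp add: c_aff_def d_aff_def)
  qed
qed

section \<open>Comparison of the two orders\<close>

text \<open>The Schwarz lemma is applied after scaling by 1 / k' and moving w(0) / k' to 0. Taking
  k' > k keeps the scaled map inside the open disk even if cmod w attains k; then k' decreases to
  k.\<close>

lemma schwarz_pick_at_0:
  assumes hol: "w holomorphic_on unit_disk" and k: "0 < k" and b: "\<And>z. z \<in> unit_disk \<Longrightarrow> cmod (w z) \<le> k"
  shows "k * cmod (deriv w 0) \<le> k\<^sup>2 - (cmod (w 0))\<^sup>2"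
proof -
  have strict: "k' * cmod (deriv w 0) \<le> k'\<^sup>2 - (cmod (w 0))\<^sup>2" if k': "k < k'" for k'
  proof -
    have k'0: "k' > 0" using k k' by simp
    define v where "v = (\<lambda>z. w z / of_real k')"
    have vb: "v z \<in> unit_disk" if "z \<in> unit_disk" for z
      using b[OF that] k' k'0 by (simp add: v_def norm_divide)
    define c where "c = v 0"
    have c: "c \<in> unit_disk" using vb[of 0] by (simp add: c_def)
    have c2: "0 < 1 - (cmod c)\<^sup>2" using disk_defect_pos[OF c] .
    define \<psi> where "\<psi> = (\<lambda>z. (v z - c) / (1 - cnj c * v z))"
    have nz: "1 - cnj c * v z \<noteq> 0" if "z \<in> unit_disk" for z
      by (rule disk_denominator_nonzero[OF c vb[OF that]])
    have vhol: "v holomorphic_on unit_disk"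
      unfolding v_def using k'0 by (intro holomorphic_intros hol) auto
    have "\<psi> holomorphic_on unit_disk"
      unfolding \<psi>_def using nz by (intro holomorphic_intros vhol)
    moreover have "\<psi> 0 = 0" by (simp add: \<psi>_def c_def)
    moreover have "cmod (\<psi> z) < 1" if "cmod z < 1" for z
    proof -
      have "\<psi> z = affine_moebius 1 (- cnj c) (v z)" by (simp add: \<psi>_def affine_moebius_def)
      then show ?thesis using affine_moebius_in_disk[of "- cnj c" 1 "v z"] vb[of z] c that by simp
    qed
    ultimately have le: "cmod (deriv \<psi> 0) \<le> 1" by (rule Schwarz_Lemma(2)[where \<xi> = 0]) simp_all
    have dv: "(v has_field_derivative deriv v 0) (at 0)"
      by (rule holomorphic_derivI[OF vhol open_ball]) simp
    have "(w has_field_derivative deriv w 0) (at 0)"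
      by (rule holomorphic_derivI[OF hol open_ball]) simp
    then have dv0: "deriv v 0 = deriv w 0 / of_real k'"
      unfolding v_def using k'0 by (intro DERIV_imp_deriv DERIV_cdivide)
    have "(\<psi> has_field_derivative (deriv v 0 * (1 - cnj c * v 0) - (v 0 - c) * (- (cnj c * deriv v 0)))
        / ((1 - cnj c * v 0) * (1 - cnj c * v 0))) (at 0)"
      unfolding \<psi>_def using nz[of 0] by (auto intro!: derivative_eq_intros dv)
    then have "deriv \<psi> 0 = deriv v 0 / (1 - cnj c * c)"
      using nz[of 0] by (simp add: DERIV_imp_deriv c_def)
    also have "1 - cnj c * c = of_real (1 - (cmod c)\<^sup>2)"
      by (simp add: complex_norm_square[symmetric] mult.commute)
    finally have d\<psi>: "deriv \<psi> 0 = deriv v 0 / of_real (1 - (cmod c)\<^sup>2)" .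
    have "cmod (deriv w 0) / k' \<le> 1 - (cmod c)\<^sup>2"
    proof -
      have "cmod (deriv \<psi> 0) = cmod (deriv w 0) / k' / (1 - (cmod c)\<^sup>2)"
        unfolding d\<psi> dv0 norm_divide norm_of_real using c2 k'0 by (simp only: abs_of_pos)
      then show ?thesis using le c2 by (simp only: pos_divide_le_eq mult_1)
    qed
    then have "cmod (deriv w 0) * k' \<le> (1 - (cmod c)\<^sup>2) * k' * k'" using k'0 by (simp add: divide_le_eq)
    also have "\<dots> = k'\<^sup>2 - (cmod (w 0))\<^sup>2"
      using k'0 by (simp add: c_def v_def norm_divide power2_eq_square field_simps)
    finally show ?thesis by (simp add: mult.commute)
  qed
  show ?thesis
  proof (rule tendsto_le[OF trivial_limit_at_right_real])
    show "((\<lambda>k'. k' * cmod (deriv w 0)) \<longlongrightarrow> k * cmod (deriv w 0)) (at_right k)"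
      and "((\<lambda>k'. k'\<^sup>2 - (cmod (w 0))\<^sup>2) \<longlongrightarrow> k\<^sup>2 - (cmod (w 0))\<^sup>2) (at_right k)"
      by (intro tendsto_intros)+
    show "eventually (\<lambda>k'. k' * cmod (deriv w 0) \<le> k'\<^sup>2 - (cmod (w 0))\<^sup>2) (at_right k)"
      using strict by (intro eventually_at_rightI[of _ "k + 1"]) auto
  qed
qed

text \<open>The number y = sqrt x_k is the critical point in s of s (k^2 - s^2) / (k (1 - s^2)). A
  vanishing derivative is the stated equation, quadratic in x = y^2 with x_k as its smaller root;
  eliminating k^2 - y^2 turns the critical value into 2 y^3 / (k (1 + y^2)).\<close>

lemma order_gap_critical_point:
  assumes k: "0 < k" "k < 1"
  obtains y where "0 < y" "y \<le> k" "k\<^sup>2 * (1 + y\<^sup>2) = y\<^sup>2 * (3 - y\<^sup>2)" "order_gap k = 2 * y ^ 3 / (k * (1 + y\<^sup>2))"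
proof -
  define r where "r = sqrt ((1 - k\<^sup>2) * (9 - k\<^sup>2))"
  define x where "x = (3 - k\<^sup>2 - r) / 2"
  have k2: "0 < k\<^sup>2" "k\<^sup>2 < 1" using k by (auto simp: abs_square_less_1)
  have r2: "r\<^sup>2 = (1 - k\<^sup>2) * (9 - k\<^sup>2)" using k2 by (simp add: r_def)
  have r0: "0 \<le> r" using k2 by (simp add: r_def)
  \<comment> \<open>The right side is the discriminant of x^2 - (3 - k^2) x + k^2, so the smaller
    root is positive.\<close>
  have "r\<^sup>2 = (3 - k\<^sup>2)\<^sup>2 - 4 * k\<^sup>2" unfolding r2 by (simp add: power2_eq_square algebra_simps)
  then have "r < 3 - k\<^sup>2" using k2 by (intro power_less_imp_less_base[of r 2]) auto
  then have x0: "x > 0" by (simp add: x_def)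
  \<comment> \<open>This gives x <= 1, hence 1 + y^2 <= 3 - y^2, and the critical equation then
    yields y <= k.\<close>
  have "r \<ge> 1 - k\<^sup>2"
  proof (rule power2_le_imp_le[OF _ r0])
    show "(1 - k\<^sup>2)\<^sup>2 \<le> r\<^sup>2" unfolding r2 power2_eq_square[of "1 - _"] using k2 by (intro mult_left_mono) auto
  qed
  then have x1: "x \<le> 1" by (simp add: x_def)
  have "4 * x\<^sup>2 = (3 - k\<^sup>2 - r)\<^sup>2" by (simp add: x_def power_divide)
  also have "\<dots> = (3 - k\<^sup>2)\<^sup>2 - 2 * (3 - k\<^sup>2) * r + r\<^sup>2" by (simp add: power2_diff)
  finally have xq: "x\<^sup>2 - (3 - k\<^sup>2) * x + k\<^sup>2 = 0"
    unfolding r2 by (simp add: x_def power2_eq_square algebra_simps field_simps)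
  define y where "y = sqrt x"
  have y: "y > 0" "y\<^sup>2 = x" using x0 by (auto simp: y_def)
  have eq: "k\<^sup>2 * (1 + y\<^sup>2) = y\<^sup>2 * (3 - y\<^sup>2)"
    using xq unfolding y(2) by (simp add: power2_eq_square algebra_simps)
  have "y\<^sup>2 * (1 + y\<^sup>2) \<le> k\<^sup>2 * (1 + y\<^sup>2)"
    unfolding eq using y x1 x0 by (intro mult_left_mono) auto
  then have "y\<^sup>2 \<le> k\<^sup>2" using x0 y(2) by simp
  then have "y \<le> k" by (rule power2_le_imp_le) (use k in simp)
  moreover have "x powr (3 / 2) = y ^ 3"
  proof -
    have "x powr (3 / 2) = (x powr (1 / 2)) powr 3" by (simp add: powr_powr)
    also have "\<dots> = y powr real 3" using x0 by (simp add: powr_half_sqrt y_def)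
    also have "\<dots> = y ^ 3" using y by (intro powr_realpow)
    finally show ?thesis .
  qed
  then have "order_gap k = 2 * y ^ 3 / (k * (1 + y\<^sup>2))"
    using k y(2) by (simp add: order_gap_def Let_def x_def r_def)
  ultimately show thesis using that y(1) eq by blast
qed

lemma order_gap_is_upper_bound:
  assumes k: "0 < k" "k < 1" and s: "0 \<le> s" "s \<le> k"
  shows "s * (k\<^sup>2 - s\<^sup>2) / (k * (1 - s\<^sup>2)) \<le> order_gap k"
proof -
  obtain y where y: "0 < y" "k\<^sup>2 * (1 + y\<^sup>2) = y\<^sup>2 * (3 - y\<^sup>2)" "order_gap k = 2 * y ^ 3 / (k * (1 + y\<^sup>2))"
    using order_gap_critical_point[OF k] by metis
  have s1: "0 < 1 - s\<^sup>2" using k s by (simp add: abs_square_less_1)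
  \<comment> \<open>Tangency at the maximum: with denominators cleared, the difference of the two
    sides has a double root at s = y, and the remaining linear factor is nonnegative for s >=
    0.\<close>
  have "0 \<le> (s - y)\<^sup>2 * ((1 + y\<^sup>2) * s + 2 * y)" using s y by simp
  also have "\<dots> = 2 * y ^ 3 * (1 - s\<^sup>2) - s * (y\<^sup>2 * (3 - y\<^sup>2) - s\<^sup>2 * (1 + y\<^sup>2))"
    by (simp add: power2_eq_square power3_eq_cube algebra_simps)
  also have "\<dots> = 2 * y ^ 3 * (1 - s\<^sup>2) - s * (k\<^sup>2 - s\<^sup>2) * (1 + y\<^sup>2)"
    unfolding y(2)[symmetric] by (simp add: algebra_simps)
  finally have le: "s * (k\<^sup>2 - s\<^sup>2) * (1 + y\<^sup>2) \<le> 2 * y ^ 3 * (1 - s\<^sup>2)" by simp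
  have p: "0 < k * (1 - s\<^sup>2)" "0 < k * (1 + y\<^sup>2)" using k s1 by (auto intro!: mult_pos_pos add_pos_nonneg)
  have "k * (s * (k\<^sup>2 - s\<^sup>2) * (1 + y\<^sup>2)) \<le> k * (2 * y ^ 3 * (1 - s\<^sup>2))"
    using le k by (intro mult_left_mono) auto
  then have "s * (k\<^sup>2 - s\<^sup>2) * (k * (1 + y\<^sup>2)) \<le> 2 * y ^ 3 * (k * (1 - s\<^sup>2))"
    by (simp only: mult_ac)
  then show ?thesis
    unfolding y(3) pos_divide_le_eq[OF p(1)] times_divide_eq_left pos_le_divide_eq[OF p(2)] .
qed

text \<open>As y <= 1, the critical equation gives 2 y^2 <= k^2 (1 + y^2); a further factor y <= k
  gives the quadratic bound.\<close>

lemma order_gap_bounds: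
  assumes "0 \<le> k" "k < 1"
  shows "0 \<le> order_gap k" "order_gap k \<le> k\<^sup>2"
proof -
  have "0 \<le> order_gap k \<and> order_gap k \<le> k\<^sup>2"
  proof (cases "k = 0")
    case True
    then show ?thesis by (simp add: order_gap_def)
  next
    case False
    then have k: "0 < k" "k < 1" using assms by auto
    obtain y where y: "0 < y" "y \<le> k" "k\<^sup>2 * (1 + y\<^sup>2) = y\<^sup>2 * (3 - y\<^sup>2)" "order_gap k = 2 * y ^ 3 / (k * (1 + y\<^sup>2))"
      using order_gap_critical_point[OF k] by metis
    have "y\<^sup>2 \<le> 1" using y k by (simp add: power_le_one)
    then have "y\<^sup>2 * 2 \<le> y\<^sup>2 * (3 - y\<^sup>2)" by (intro mult_left_mono) auto
    then have "2 * y\<^sup>2 \<le> k\<^sup>2 * (1 + y\<^sup>2)" unfolding y(3) by simp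
    then have "y * (2 * y\<^sup>2) \<le> k * (k\<^sup>2 * (1 + y\<^sup>2))"
      using y(1,2) k by (intro mult_mono[OF y(2)]) auto
    then have "2 * y ^ 3 \<le> k\<^sup>2 * (k * (1 + y\<^sup>2))"
      by (simp add: power2_eq_square power3_eq_cube mult_ac)
    moreover have "0 < k * (1 + y\<^sup>2)" using k by (intro mult_pos_pos add_pos_nonneg) auto
    ultimately show ?thesis using y(1) by (simp add: y(4) divide_le_eq)
  qed
  then show "0 \<le> order_gap k" "order_gap k \<le> k\<^sup>2" by auto
qed

section \<open>Decay of the gap for small defect\<close>

lemma tanh_le_self: "0 \<le> x \<Longrightarrow> tanh x \<le> (x::real)"
proof -
  assume x: "0 \<le> x"
  have "(sinh x - x * cosh x) \<le> (sinh 0 - 0 * cosh 0)"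
  proof (rule DERIV_nonpos_imp_nonincreasing[OF x])
    fix t :: real assume "0 \<le> t" "t \<le> x"
    have "((\<lambda>t. sinh t - t * cosh t) has_real_derivative - (t * sinh t)) (at t)"
      by (auto intro!: derivative_eq_intros)
    then show "\<exists>y. ((\<lambda>t. sinh t - t * cosh t) has_real_derivative y) (at t) \<and> y \<le> 0"
      using \<open>0 \<le> t\<close> by (intro exI[of _ "- (t * sinh t)"]) auto
  qed
  then show "tanh x \<le> x" by (simp add: tanh_def divide_le_eq)
qed

text \<open>Only the linear order in D matters. The inequalities tanh x <= x and x <= sinh x reduce
  the claim to an upper bound for sinh (D / 2), where D <= 1 makes the quadratic estimate of exp
  available.\<close>

lemma tanh_jung_radius_bounds:
  assumes D: "0 \<le> D" "D \<le> 1"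
  shows "0 \<le> tanh (jung_radius D / 2)" "tanh (jung_radius D / 2) \<le> D"
proof -
  have sh: "0 \<le> 2 / sqrt 3 * sinh (D / 2)" using D by simp
  then have J0: "0 \<le> jung_radius D" unfolding jung_radius_def by (metis arsinh_real_neg_iff not_less)
  then show "0 \<le> tanh (jung_radius D / 2)" by simp
  have sinh_ge: "x \<le> sinh x" if "0 \<le> x" for x :: real
  proof -
    have "(sinh 0 - 0) \<le> (sinh x - x)"
    proof (rule DERIV_nonneg_imp_nondecreasing[OF that])
      fix t :: real
      have "((\<lambda>t. sinh t - t) has_real_derivative cosh t - 1) (at t)"
        by (auto intro!: derivative_eq_intros)
      then show "\<exists>y. ((\<lambda>t. sinh t - t) has_real_derivative y) (at t) \<and> y \<ge> 0"
        by (intro exI[of _ "cosh t - 1"]) (simp add: cosh_real_ge_1)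
    qed
    then show ?thesis by simp
  qed
  have "sinh (D / 2) \<le> D"
  proof -
    have "exp (D / 2) \<le> 1 + D / 2 + (D / 2)\<^sup>2" by (rule exp_bound) (use D in auto)
    moreover have "exp (- (D / 2)) \<ge> 1 + - (D / 2)" by (rule exp_ge_add_one_self)
    moreover have "(D / 2)\<^sup>2 \<le> D / 2" using D mult_left_mono[of "D / 2" 1 "D / 2"] by (simp add: power2_eq_square)
    ultimately show ?thesis using D by (simp add: sinh_def)
  qed
  moreover have "2 / sqrt 3 \<le> 2" by (simp add: divide_le_eq)
  ultimately have "2 / sqrt 3 * sinh (D / 2) \<le> 2 * D" using D by (intro mult_mono) auto
  moreover have "jung_radius D \<le> 2 / sqrt 3 * sinh (D / 2)"
    using sinh_ge[OF J0] by (simp add: jung_radius_def)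
  moreover have "tanh (jung_radius D / 2) \<le> jung_radius D / 2" using J0 by (intro tanh_le_self) simp
  ultimately show "tanh (jung_radius D / 2) \<le> D" by linarith
qed

lemma order_gap_jung_bound:
  assumes "0 \<le> D" "D \<le> 1"
  shows "0 \<le> order_gap (tanh (jung_radius D / 2))" "order_gap (tanh (jung_radius D / 2)) \<le> D\<^sup>2"
proof -
  note t = tanh_jung_radius_bounds[OF assms]
  note g = order_gap_bounds[OF t(1) tanh_real_lt_1]
  show "0 \<le> order_gap (tanh (jung_radius D / 2))" by (rule g(1))
  show "order_gap (tanh (jung_radius D / 2)) \<le> D\<^sup>2"
    by (rule order_trans[OF g(2) power_mono[OF t(2,1)]])
qed

section \<open>From a single representative to the orders\<close>

lemma a2_pre_schwarzian_gap:
  assumes F: "admissible F" "deriv (analytic_part F) 0 = 1"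
    and k: "disk_norm (dilatation F) \<le> k" "k < 1"
  shows "\<bar>cmod (a2 F) - 1 / 2 * cmod (pre_schwarzian F 0)\<bar> \<le> 1 / 2 * order_gap k"
proof -
  have op: "op_harmonic F" using F by (simp add: admissible_def)
  define w where "w = dilatation F"
  have wk: "cmod (w z) \<le> k" if "z \<in> unit_disk" for z
    using dilatation_le_disk_norm[OF op that] k(1) by (simp add: w_def)
  have k0: "0 \<le> k" using disk_norm_nonneg[OF op] k by simp
  define s where "s = cmod (w 0)"
  have s: "0 \<le> s" "s \<le> k" using wk[of 0] by (auto simp: s_def)
  have s1: "0 < 1 - s\<^sup>2" using s k by (simp add: abs_square_less_1)
  have "a2 F = deriv (deriv (analytic_part F)) 0 / 2"
    by (simp add: a2_def numeral_2_eq_2)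
  then have P: "a2 F - pre_schwarzian F 0 / 2 = cnj (w 0) * deriv w 0 / (1 - of_real (s\<^sup>2)) / 2"
    using pre_schwarzian_formula[OF op, of 0] F(2) by (simp add: w_def s_def diff_divide_distrib)
  have "cmod (1 - complex_of_real (s\<^sup>2)) = 1 - s\<^sup>2"
    using s1 by (metis abs_of_pos norm_of_real of_real_1 of_real_diff)
  then have "cmod (a2 F - pre_schwarzian F 0 / 2) = 1 / 2 * (s * cmod (deriv w 0) / (1 - s\<^sup>2))"
    unfolding P norm_divide norm_mult complex_mod_cnj s_def[symmetric] by simp
  also have "s * cmod (deriv w 0) / (1 - s\<^sup>2) \<le> order_gap k"
  proof (cases "k = 0")
    \<comment> \<open>Dividing the Schwarz-Pick bound by k is impossible here; s <= k = 0 makes the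
      left side 0, matching the separate value of \<open>order_gap\<close> at 0.\<close>
    case True
    then show ?thesis using s by (simp add: order_gap_def)
  next
    case False
    then have kp: "0 < k" using k0 by simp
    have "k * cmod (deriv w 0) \<le> k\<^sup>2 - s\<^sup>2"
      unfolding s_def by (rule schwarz_pick_at_0[OF _ kp wk]) (use dilatation_holomorphic[OF op] in \<open>simp add: w_def\<close>)
    then have "cmod (deriv w 0) \<le> (k\<^sup>2 - s\<^sup>2) / k" using kp by (simp add: le_divide_eq mult.commute)
    then have "s * cmod (deriv w 0) / (1 - s\<^sup>2) \<le> s * ((k\<^sup>2 - s\<^sup>2) / k) / (1 - s\<^sup>2)"
      using s s1 by (intro divide_right_mono mult_left_mono) auto
    also have "\<dots> = s * (k\<^sup>2 - s\<^sup>2) / (k * (1 - s\<^sup>2))" by simp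
    also have "\<dots> \<le> order_gap k" by (rule order_gap_is_upper_bound[OF kp k(2) s])
    finally show ?thesis .
  qed
  finally have "cmod (a2 F - pre_schwarzian F 0 / 2) \<le> 1 / 2 * order_gap k" by simp
  moreover have "\<bar>cmod (a2 F) - cmod (pre_schwarzian F 0 / 2)\<bar> \<le> cmod (a2 F - pre_schwarzian F 0 / 2)"
    by (rule norm_triangle_ineq3)
  ultimately show ?thesis by (simp add: norm_divide)
qed

text \<open>The bound depends on k alone, which is what makes the supremum over a whole family
  finite.\<close>

lemma a2_bounded:
  assumes F: "admissible F" "deriv (analytic_part F) 0 = 1"
    and k: "disk_norm (dilatation F) \<le> k" "k < 1"
  shows "cmod (a2 F) \<le> 200000 * exp 9 / (1 - k)"
proof -
  have op: "op_harmonic F" and inj: "inj_on F unit_disk" using F by (auto simp: admissible_def univalent_def)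
  define h g where "h = analytic_part F" and "g = coanalytic_part F"
  have d: "harmonic_decomp F h g" using op_harmonic_decomp[OF op] by (simp add: h_def g_def)
  have nz: "deriv h z \<noteq> 0" if "z \<in> unit_disk" for z
    using deriv_analytic_part_nonzero[OF op that] by (simp add: h_def)
  have "cmod (deriv (deriv h) 0 / deriv h 0) \<le> 200000 * exp 9 / (1 - k)"
  proof (rule univalent_harmonic_second_derivative_bound[where g = g])
    show "h holomorphic_on unit_disk" "g holomorphic_on unit_disk" using d by (auto simp: harmonic_decomp_def)
    show "inj_on (\<lambda>z. h z + cnj (g z)) unit_disk"
      using inj d by (simp add: harmonic_decomp_def inj_on_def)
    show "0 \<le> k" using disk_norm_nonneg[OF op] k by simp
    fix z :: complex assume z: "z \<in> unit_disk"
    have "cmod (deriv g z / deriv h z) \<le> k"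
      using dilatation_le_disk_norm[OF op z] k(1) dilatation_eq[OF d z] by simp
    then show "cmod (deriv g z) \<le> k * cmod (deriv h z)" using nz[OF z] by (simp add: norm_divide divide_le_eq)
  qed (use nz k in auto)
  moreover have "a2 F = deriv (deriv h) 0 / 2" by (simp add: a2_def numeral_2_eq_2 h_def)
  ultimately have "2 * cmod (a2 F) \<le> 200000 * exp 9 / (1 - k)"
    using F(2) unfolding h_def by (simp add: norm_divide del: eq_divide_eq_numeral1)
  then show ?thesis using norm_ge_zero[of "a2 F"] by linarith
qed

text \<open>The bound B and the gap make both suprema finite, so they agree with the real ones,
  where the comparison is elementary. A bound on p suffices because q differs from it by at most
  \<epsilon>.\<close>

lemma SUP_ereal_gap:
  fixes p q :: "'a \<Rightarrow> real"
  assumes ne: "S \<noteq> {}" and B: "\<And>x. x \<in> S \<Longrightarrow> p x \<le> B" and gap: "\<And>x. x \<in> S \<Longrightarrow> \<bar>p x - q x\<bar> \<le> \<epsilon>"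
  shows "\<bar>(SUP x\<in>S. ereal (p x)) - (SUP x\<in>S. ereal (q x))\<bar> \<le> ereal \<epsilon>"
proof -
  have bp: "bdd_above (p ` S)" using B by (intro bdd_aboveI2)
  have qB: "q x \<le> B + \<epsilon>" if "x \<in> S" for x using B[OF that] gap[OF that] by linarith
  then have bq: "bdd_above (q ` S)" by (intro bdd_aboveI2)
  have "(SUP x\<in>S. p x) \<le> (SUP x\<in>S. q x) + \<epsilon>"
  proof (rule cSUP_least[OF ne])
    fix x assume "x \<in> S"
    then show "p x \<le> (SUP x\<in>S. q x) + \<epsilon>" using gap[of x] cSUP_upper[OF _ bq, of x] by linarith
  qed
  moreover have "(SUP x\<in>S. q x) \<le> (SUP x\<in>S. p x) + \<epsilon>"
  proof (rule cSUP_least[OF ne])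
    fix x assume "x \<in> S"
    then show "q x \<le> (SUP x\<in>S. p x) + \<epsilon>" using gap[of x] cSUP_upper[OF _ bp, of x] by linarith
  qed
  ultimately have le: "\<bar>(SUP x\<in>S. p x) - (SUP x\<in>S. q x)\<bar> \<le> \<epsilon>" by linarith
  have real: "(SUP x\<in>S. ereal (f x)) = ereal (SUP x\<in>S. f x)" if "bdd_above (f ` S)" for f
  proof (rule antisym)
    show "(SUP x\<in>S. ereal (f x)) \<le> ereal (SUP x\<in>S. f x)"
      using cSUP_upper[OF _ that] by (intro SUP_least) simp
    have fin: "\<bar>SUP x\<in>S. ereal (f x)\<bar> \<noteq> \<infinity>"
    proof -
      obtain x where "x \<in> S" using ne by blast
      then have "ereal (f x) \<le> (SUP x\<in>S. ereal (f x))" by (rule SUP_upper)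
      moreover have "(SUP x\<in>S. ereal (f x)) \<le> ereal (SUP x\<in>S. f x)" by fact
      ultimately show ?thesis by auto
    qed
    then obtain r where r: "(SUP x\<in>S. ereal (f x)) = ereal r" by (auto simp: ereal_infinity_cases)
    have "(SUP x\<in>S. f x) \<le> r"
    proof (rule cSUP_least[OF ne])
      fix x assume "x \<in> S"
      then have "ereal (f x) \<le> ereal r" unfolding r[symmetric] by (rule SUP_upper)
      then show "f x \<le> r" by simp
    qed
    then show "ereal (SUP x\<in>S. f x) \<le> (SUP x\<in>S. ereal (f x))" by (simp add: r)
  qed
  show ?thesis using le by (simp add: real[OF bp] real[OF bq])
qed

lemma order_difference_bound:
  assumes \<F>: "invariant_class \<F>" and k: "k < 1"
    and dil: "\<And>F. F \<in> balanced_section \<F> \<Longrightarrow> disk_norm (dilatation F) \<le> k"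
  shows "\<bar>alpha_order \<F> - sigma_order \<F>\<bar> \<le> ereal (1 / 2 * order_gap k)"
proof -
  have ne: "balanced_section \<F> \<noteq> {}" by (rule balanced_section_nonempty[OF \<F>])
  \<comment> \<open>The factor 1/2 moves inside, so that both orders are suprema over the same index
    set with a termwise gap.\<close>
  have "sigma_order \<F> = (SUP F\<in>balanced_section \<F>. ereal (1 / 2) * ereal (cmod (pre_schwarzian F 0)))"
    unfolding sigma_order_def by (rule SUP_ereal_mult_left[OF ne, symmetric]) auto
  then have \<sigma>: "sigma_order \<F> = (SUP F\<in>balanced_section \<F>. ereal (1 / 2 * cmod (pre_schwarzian F 0)))"
    by simp
  show ?thesis
    unfolding alpha_order_def \<sigma>
    using balanced_section_properties[OF \<F>] dil k
    by (intro SUP_ereal_gap[OF ne, where B = "200000 * exp 9 / (1 - k)"] a2_bounded a2_pre_schwarzian_gap) auto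
qed

lemma order_difference_bound_jung:
  assumes "invariant_class \<F>" "balanced_section \<F> \<subseteq> S_balanced D"
  shows "\<bar>alpha_order \<F> - sigma_order \<F>\<bar> \<le> ereal (1 / 2 * order_gap (tanh (jung_radius D / 2)))"
  using assms S_balanced_dilatation_bound by (intro order_difference_bound tanh_real_lt_1) auto

theorem theorem10p1:
  shows
    "(\<forall>\<F> k0. invariant_class \<F> \<longrightarrow> k0 < 1 \<longrightarrow>
        (\<forall>F\<in>balanced_section \<F>. disk_norm (dilatation F) \<le> k0) \<longrightarrow>
        \<bar>alpha_order \<F> - sigma_order \<F>\<bar> \<le> ereal (1 / 2 * order_gap k0))
     \<and> (\<forall>\<F> D. invariant_class \<F> \<longrightarrow> balanced_section \<F> \<subseteq> S_balanced D \<longrightarrow>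
        tanh (jung_radius D / 2) < 1 \<and>
        (\<forall>F\<in>balanced_section \<F>. disk_norm (dilatation F) \<le> tanh (jung_radius D / 2)) \<and>
        \<bar>alpha_order \<F> - sigma_order \<F>\<bar> \<le> ereal (1 / 2 * order_gap (tanh (jung_radius D / 2))))
     \<and> (\<lambda>D. 1 / 2 * order_gap (tanh (jung_radius D / 2))) \<in> O[at_right 0](\<lambda>D. D\<^sup>2)
     \<and> (\<exists>K. \<exists>\<delta>>0. \<forall>D \<F>. 0 \<le> D \<longrightarrow> D \<le> \<delta> \<longrightarrow> invariant_class \<F> \<longrightarrow>
          balanced_section \<F> \<subseteq> S_balanced D \<longrightarrow>
          \<bar>alpha_order \<F> - sigma_order \<F>\<bar> \<le> ereal (K * D\<^sup>2))"
proof (intro conjI allI impI ballI)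
  show "\<bar>alpha_order \<F> - sigma_order \<F>\<bar> \<le> ereal (1 / 2 * order_gap k0)"
    if "invariant_class \<F>" "k0 < 1" "\<forall>F\<in>balanced_section \<F>. disk_norm (dilatation F) \<le> k0" for \<F> k0
    using that by (intro order_difference_bound) auto
  show "tanh (jung_radius D / 2) < 1" for D by (rule tanh_real_lt_1)
  show "disk_norm (dilatation F) \<le> tanh (jung_radius D / 2)"
    if "balanced_section \<F> \<subseteq> S_balanced D" "F \<in> balanced_section \<F>" for \<F> D F
    using that S_balanced_dilatation_bound by blast
  show "\<bar>alpha_order \<F> - sigma_order \<F>\<bar> \<le> ereal (1 / 2 * order_gap (tanh (jung_radius D / 2)))"
    if "invariant_class \<F>" "balanced_section \<F> \<subseteq> S_balanced D" for \<F> D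
    using that by (rule order_difference_bound_jung)
  have "eventually (\<lambda>D::real. D \<in> {0<..<1}) (at_right 0)" by (intro eventually_at_rightI[of _ 1]) auto
  then show "(\<lambda>D. 1 / 2 * order_gap (tanh (jung_radius D / 2))) \<in> O[at_right 0](\<lambda>D. D\<^sup>2)"
  proof (intro bigoI[where c = "1 / 2"], elim eventually_mono)
    fix D :: real assume "D \<in> {0<..<1}"
    then show "norm (1 / 2 * order_gap (tanh (jung_radius D / 2))) \<le> 1 / 2 * norm (D\<^sup>2)"
      using order_gap_jung_bound[of D] by simp
  qed
  \<comment> \<open>The estimate of \<open>order_gap\<close> by D^2 holds on all of [0, 1] and does
    not involve the family, so K = 1/2 and \<delta> = 1 work uniformly.\<close>
  show "\<exists>K. \<exists>\<delta>>0. \<forall>D \<F>. 0 \<le> D \<longrightarrow> D \<le> \<delta> \<longrightarrow> invariant_class \<F> \<longrightarrow>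
          balanced_section \<F> \<subseteq> S_balanced D \<longrightarrow>
          \<bar>alpha_order \<F> - sigma_order \<F>\<bar> \<le> ereal (K * D\<^sup>2)"
  proof (rule exI[of _ "1 / 2"], rule exI[of _ 1], intro conjI allI impI)
    fix D :: real and \<F>
    assume D: "0 \<le> D" "D \<le> 1" and \<F>: "invariant_class \<F>" "balanced_section \<F> \<subseteq> S_balanced D"
    show "\<bar>alpha_order \<F> - sigma_order \<F>\<bar> \<le> ereal (1 / 2 * D\<^sup>2)"
      by (rule order_trans[OF order_difference_bound_jung[OF \<F>]])
        (use order_gap_jung_bound(2)[OF D] in simp)
  qed simp
qed

end
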